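(* For every compact Hausdorff space $X$, the multiplication map $\mu_{OH}X:OH(OH(X))\to OH(X)$ is open.
   Context: For a compactum $X$, $OH(X)$ is the subspace of $\prod_{\varphi\in C(X)}[\min\varphi,\max\varphi]$ (product topology) consisting of functionals $\nu:C(X)\to\mathbb{R}$ that are normed ($\nu(1_X)=1$), weakly additive ($\nu(\varphi+c_X)=\nu(\varphi)+c$ for constants $c$), order-preserving ($\varphi\le\psi\Rightarrow\nu(\varphi)\le\nu(\psi)$) and positively homogeneous ($\nu(t\varphi)=t\nu(\varphi)$, $t\ge0$). The multiplication $\mu_{OH}X:OH(OH(X))\to OH(X)$ is $\mu_{OH}X(\nu)(\varphi)=\nu(\pi_\varphi)$, where $\pi_\varphi:OH(X)\to\mathbb{R}$, $\pi_\varphi(\lambda)=\lambda(\varphi)$. *)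

theory Defs
  imports "HOL-Analysis.Analysis"
begin

definition Cfun :: "'a topology \<Rightarrow> ('a \<Rightarrow> real) set" where
  "Cfun X = {f \<in> topspace X \<rightarrow>\<^sub>E UNIV. continuous_map X euclideanreal f}"

definition is_OH :: "'a topology \<Rightarrow> (('a \<Rightarrow> real) \<Rightarrow> real) \<Rightarrow> bool" where
  "is_OH X \<nu> \<longleftrightarrow>
     \<nu> (restrict (\<lambda>x. 1) (topspace X)) = 1 \<and>
     (\<forall>\<phi>\<in>Cfun X. \<forall>c::real. \<nu> (restrict (\<lambda>x. \<phi> x + c) (topspace X)) = \<nu> \<phi> + c) \<and>
     (\<forall>\<phi>\<in>Cfun X. \<forall>\<psi>\<in>Cfun X. (\<forall>x\<in>topspace X. \<phi> x \<le> \<psi> x) \<longrightarrow> \<nu> \<phi> \<le> \<nu> \<psi>) \<and>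
     (\<forall>\<phi>\<in>Cfun X. \<forall>t::real. t \<ge> 0 \<longrightarrow> \<nu> (restrict (\<lambda>x. t * \<phi> x) (topspace X)) = t * \<nu> \<phi>)"

definition OH :: "'a topology \<Rightarrow> (('a \<Rightarrow> real) \<Rightarrow> real) topology" where
  "OH X = subtopology
     (product_topology
        (\<lambda>\<phi>. subtopology euclideanreal {Inf (\<phi> ` topspace X) .. Sup (\<phi> ` topspace X)})
        (Cfun X))
     {\<nu>. is_OH X \<nu>}"

definition muOH :: "'a topology \<Rightarrow> (((('a \<Rightarrow> real) \<Rightarrow> real) \<Rightarrow> real) \<Rightarrow> real) \<Rightarrow> (('a \<Rightarrow> real) \<Rightarrow> real)" where
  "muOH X \<nu> = restrict (\<lambda>\<phi>. \<nu> (restrict (\<lambda>l. l \<phi>) (topspace (OH X)))) (Cfun X)"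

end

theory Submission
  imports Defs
begin

text \<open>
  Let \<open>\<mu>(\<Lambda>) = \<lambda>\<close> and let \<open>\<kappa>\<close> be close to \<open>\<lambda>\<close>. Among the functionals on \<open>C(OH(X))\<close> with value \<open>\<kappa>(\<phi>)\<close>
  at every \<open>\<pi>\<^sub>\<phi>\<close> there is a smallest one, \<open>L(\<Phi>) = sup {\<kappa>(\<phi>) | \<pi>\<^sub>\<phi> \<le> \<Phi>}\<close>, and a largest one, \<open>U\<close>. Clamping
  gives \<open>\<Lambda>' = max L (min U \<Lambda>)\<close>, which is again in \<open>OH(OH(X))\<close> and satisfies \<open>\<mu>(\<Lambda>') = \<kappa>\<close>. It is close
  to \<open>\<Lambda>\<close> at \<open>\<Phi>\<close> as soon as \<open>L(\<Phi>) \<le> \<Lambda>(\<Phi>) + \<epsilon>\<close> and, dually, \<open>U(\<Phi>) \<ge> \<Lambda>(\<Phi>) - \<epsilon>\<close>.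

  For the former it suffices to have a finite set \<open>Q\<close> with \<open>\<pi>\<^sub>q \<le> \<Phi> + \<epsilon>\<close> for \<open>q \<in> Q\<close> such that every
  \<open>\<phi>\<close> with \<open>\<pi>\<^sub>\<phi> \<le> \<Phi>\<close> lies below some \<open>q \<in> Q\<close>: then \<open>\<kappa>\<close> need only be close to \<open>\<lambda>\<close> on \<open>Q\<close>. Up to
  \<open>\<epsilon>\<close>, \<open>\<Phi>(\<nu>)\<close> depends only on the values of \<open>\<nu>\<close> at a finite set \<open>F\<close>. Each enlargement \<open>\<phi> \<mapsto> q\<close> below
  is compensated by moving \<open>\<nu>\<close> to some \<open>\<nu>'\<close> with \<open>\<nu>'(\<phi>) \<ge> \<nu>(q)\<close> that is close to \<open>\<nu>\<close> on \<open>F\<close>: first \<open>\<phi>\<close>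
  is truncated from below at a level \<open>- M\<close>, then replaced by \<open>\<Sum>\<^sub>y \<rho>\<^sub>y sup\<^bsub>A y\<^esub> \<phi>\<close> for a finite partition
  of unity \<open>\<rho>\<close> subordinate to sets \<open>A y\<close> on which \<open>F\<close> oscillates little. The coefficients then lie
  in a bounded interval and are rounded up to a finite grid.
\<close>

section \<open>Weakly additive functionals\<close>

abbreviation cts :: "'a topology \<Rightarrow> ('a \<Rightarrow> real) \<Rightarrow> bool" where
  "cts X f \<equiv> continuous_map X euclideanreal f"

text \<open>The arguments are maps continuous on \<open>X\<close> with arbitrary values outside
  \<open>topspace X\<close>, so that plain abstractions can be used without \<open>restrict\<close>.
  Scaling by 0 and then adding a constant determines the value at every constant. Order preservation
  in both directions shows that only the values on \<open>topspace X\<close> matter.\<close>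

definition weak_functional :: "'a topology \<Rightarrow> (('a \<Rightarrow> real) \<Rightarrow> real) \<Rightarrow> bool" where
  "weak_functional X V \<longleftrightarrow>
     (\<forall>f c. cts X f \<longrightarrow> V (\<lambda>x. f x + c) = V f + c) \<and>
     (\<forall>f g. cts X f \<longrightarrow> cts X g \<longrightarrow> (\<forall>x\<in>topspace X. f x \<le> g x) \<longrightarrow> V f \<le> V g) \<and>
     (\<forall>f t. cts X f \<longrightarrow> t \<ge> 0 \<longrightarrow> V (\<lambda>x. t * f x) = t * V f)"

text \<open>Evaluation of a functional on functions that are not restricted to \<open>topspace X\<close>.\<close>

definition ev :: "'a topology \<Rightarrow> (('a \<Rightarrow> real) \<Rightarrow> real) \<Rightarrow> ('a \<Rightarrow> real) \<Rightarrow> real" where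
  "ev X \<nu> f = \<nu> (restrict f (topspace X))"

lemma weak_functionalD:
  assumes "weak_functional X V" "cts X f"
  shows weak_functional_add: "V (\<lambda>x. f x + c) = V f + c"
    and weak_functional_mono: "cts X g \<Longrightarrow> (\<And>x. x \<in> topspace X \<Longrightarrow> f x \<le> g x) \<Longrightarrow> V f \<le> V g"
    and weak_functional_scale: "t \<ge> 0 \<Longrightarrow> V (\<lambda>x. t * f x) = t * V f"
  using assms unfolding weak_functional_def by blast+

lemma weak_functionalI:
  assumes "\<And>f c. cts X f \<Longrightarrow> V (\<lambda>x. f x + c) = V f + c"
    and "\<And>f g. cts X f \<Longrightarrow> cts X g \<Longrightarrow> (\<And>x. x \<in> topspace X \<Longrightarrow> f x \<le> g x) \<Longrightarrow> V f \<le> V g"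
    and "\<And>f t. cts X f \<Longrightarrow> t \<ge> 0 \<Longrightarrow> V (\<lambda>x. t * f x) = t * V f"
  shows "weak_functional X V"
  using assms unfolding weak_functional_def by blast

lemma weak_functional_cong:
  assumes "weak_functional X V" "cts X f" "cts X g" "\<And>x. x \<in> topspace X \<Longrightarrow> f x = g x"
  shows "V f = V g"
  using weak_functional_mono[OF assms(1,2,3)] weak_functional_mono[OF assms(1,3,2)] assms(4)
  by fastforce

lemma weak_functional_const:
  assumes "weak_functional X V"
  shows "V (\<lambda>x. c) = c"
proof -
  have "V (\<lambda>x. 0) = 0"
    using weak_functional_scale[OF assms, of "\<lambda>x. 0" 0] by simp
  then show ?thesis
    using weak_functional_add[OF assms, of "\<lambda>x. 0" c] by simp
qed

lemma weak_functional_le_const: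
  assumes "weak_functional X V" "cts X f" "\<And>x. x \<in> topspace X \<Longrightarrow> f x \<le> c"
  shows "V f \<le> c"
  using weak_functional_mono[OF assms(1,2), of "\<lambda>x. c"] assms weak_functional_const[OF assms(1), of c]
  by simp

lemma weak_functional_ge_const:
  assumes "weak_functional X V" "cts X f" "\<And>x. x \<in> topspace X \<Longrightarrow> c \<le> f x"
  shows "c \<le> V f"
  using weak_functional_mono[OF assms(1) _ assms(2), of "\<lambda>x. c"] assms weak_functional_const[OF assms(1), of c]
  by simp

lemma weak_functional_affine:
  assumes "weak_functional X V" "cts X f" "d \<ge> 0"
  shows "V (\<lambda>x. a + d * f x) = a + d * V f"
  using weak_functional_add[OF assms(1), of "\<lambda>x. d * f x" a] weak_functional_scale[OF assms] assms(2)
  by (simp add: add.commute continuous_map_real_mult_left)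

text \<open>On an empty space the constants 0 and 1 would agree, but their values differ.\<close>

lemma weak_functional_nonempty:
  assumes "weak_functional X V"
  shows "topspace X \<noteq> {}"
proof
  assume "topspace X = {}"
  then have "V (\<lambda>x. 0) = V (\<lambda>x. 1)"
    by (intro weak_functional_cong[OF assms]) auto
  then show False
    using weak_functional_const[OF assms] by simp
qed

text \<open>No axiom involves the sum of two arbitrary functions, so the class is closed under
  pointwise maxima and minima of functionals. Clamping rests on this.\<close>

lemma weak_functional_max:
  assumes "weak_functional X V" "weak_functional X W"
  shows "weak_functional X (\<lambda>f. max (V f) (W f))"
proof (rule weak_functionalI)
  fix f g :: "'a \<Rightarrow> real" assume "cts X f" "cts X g" "\<And>x. x \<in> topspace X \<Longrightarrow> f x \<le> g x"
  then have "V f \<le> V g" "W f \<le> W g"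
    using weak_functional_mono assms by blast+
  then show "max (V f) (W f) \<le> max (V g) (W g)" by linarith
qed (use assms in \<open>auto simp: weak_functional_add weak_functional_scale max_mult_distrib_left\<close>)

text \<open>Conjugation by negation exchanges smallest and largest functionals, and hence upper and
  lower estimates.\<close>

lemma weak_functional_dual:
  assumes "weak_functional X V"
  shows "weak_functional X (\<lambda>f. - V (\<lambda>x. - f x))"
proof (rule weak_functionalI)
  fix f :: "'a \<Rightarrow> real" and c assume f: "cts X f"
  show "- V (\<lambda>x. - (f x + c)) = - V (\<lambda>x. - f x) + c"
    using weak_functional_add[OF assms, of "\<lambda>x. - f x" "-c"] f by (simp add: continuous_map_minus)
next
  fix f :: "'a \<Rightarrow> real" and t::real assume f: "cts X f" "t \<ge> 0"
  show "- V (\<lambda>x. - (t * f x)) = t * - V (\<lambda>x. - f x)"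
    using weak_functional_scale[OF assms, of "\<lambda>x. - f x" t] f by (simp add: continuous_map_minus)
next
  fix f g :: "'a \<Rightarrow> real" assume "cts X f" "cts X g" "\<And>x. x \<in> topspace X \<Longrightarrow> f x \<le> g x"
  then show "- V (\<lambda>x. - f x) \<le> - V (\<lambda>x. - g x)"
    using weak_functional_mono[OF assms, of "\<lambda>x. - g x" "\<lambda>x. - f x"] by (simp add: continuous_map_minus)
qed

lemma weak_functional_min:
  assumes "weak_functional X V" "weak_functional X W"
  shows "weak_functional X (\<lambda>f. min (V f) (W f))"
proof (rule weak_functionalI)
  fix f g :: "'a \<Rightarrow> real" assume "cts X f" "cts X g" "\<And>x. x \<in> topspace X \<Longrightarrow> f x \<le> g x"
  then have "V f \<le> V g" "W f \<le> W g"
    using weak_functional_mono assms by blast+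
  then show "min (V f) (W f) \<le> min (V g) (W g)" by linarith
qed (use assms in \<open>auto simp: weak_functional_add weak_functional_scale min_mult_distrib_left\<close>)

section \<open>Extrema of continuous functions and smallest functionals with prescribed
  values\<close>

lemma cts_bounded:
  assumes "compact_space X" "cts X f"
  obtains B where "B > 0" "\<And>x. x \<in> topspace X \<Longrightarrow> \<bar>f x\<bar> \<le> B"
proof -
  have "compact (f ` topspace X)"
    using image_compactin[OF _ assms(2)] assms(1) by (simp add: compact_space_def)
  then have "bounded (f ` topspace X)"
    by (rule compact_imp_bounded)
  then obtain B where "B > 0" "\<forall>y\<in>f ` topspace X. norm y \<le> B"
    unfolding bounded_pos by blast
  then show ?thesis using that by auto
qed

lemma cts_attains_max:
  assumes "compact_space X" "cts X f" "topspace X \<noteq> {}"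
  obtains x0 where "x0 \<in> topspace X" "\<And>x. x \<in> topspace X \<Longrightarrow> f x \<le> f x0"
proof -
  have "compact (f ` topspace X)"
    using image_compactin[OF _ assms(2)] assms(1) by (simp add: compact_space_def)
  then obtain s where "s \<in> f ` topspace X" "\<forall>t\<in>f ` topspace X. t \<le> s"
    using compact_attains_sup[of "f ` topspace X"] assms(3) by blast
  then show ?thesis using that by auto
qed

text \<open>The smallest functional taking a value at least \<open>v\<close> at each \<open>g\<close> with \<open>P g v\<close>.\<close>

definition lower_extension ::
  "'a topology \<Rightarrow> (('a \<Rightarrow> real) \<Rightarrow> real \<Rightarrow> bool) \<Rightarrow> ('a \<Rightarrow> real) \<Rightarrow> real" where
  "lower_extension X P f = Sup {v. \<exists>g. P g v \<and> (\<forall>x\<in>topspace X. g x \<le> f x)}"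

text \<open>\<open>P g v\<close> prescribes the value \<open>v\<close> at \<open>g\<close>. Closure
  under translation and scaling is inherited by the supremum. Together with it, \<open>ne\<close>
  supplies all constants, so the supremum is over a nonempty set; \<open>bound\<close> makes it
  finite and gives the value 0 at 0.\<close>

locale extension_data =
  fixes X :: "'a topology" and P :: "('a \<Rightarrow> real) \<Rightarrow> real \<Rightarrow> bool"
  assumes compact: "compact_space X"
    and ne: "\<exists>g v. P g v"
    and add: "\<And>g v c. P g v \<Longrightarrow> P (\<lambda>x. g x + c) (v + c)"
    and scale: "\<And>g v t. P g v \<Longrightarrow> t \<ge> 0 \<Longrightarrow> P (\<lambda>x. t * g x) (t * v)"
    and bound: "\<And>g v b. P g v \<Longrightarrow> (\<And>x. x \<in> topspace X \<Longrightarrow> g x \<le> b) \<Longrightarrow> v \<le> b"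
begin

lemma const: "P (\<lambda>x. c) c"
proof -
  obtain g v where "P g v" using ne by blast
  from add[OF scale[OF this, of 0], of c] show ?thesis by simp
qed

lemma upper:
  assumes "cts X f" "P g v" "\<And>x. x \<in> topspace X \<Longrightarrow> g x \<le> f x"
  shows "v \<le> lower_extension X P f"
proof -
  obtain B where B: "\<And>x. x \<in> topspace X \<Longrightarrow> \<bar>f x\<bar> \<le> B"
    using cts_bounded[OF compact assms(1)] by metis
  have "w \<le> B" if "P h w" "\<forall>x\<in>topspace X. h x \<le> f x" for h w
    by (rule bound[OF that(1)]) (use B that(2) in fastforce)
  then have "bdd_above {v. \<exists>g. P g v \<and> (\<forall>x\<in>topspace X. g x \<le> f x)}"
    by (auto simp: bdd_above_def)
  then show ?thesis
    unfolding lower_extension_def using assms by (intro cSup_upper) auto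
qed

lemma least:
  assumes "cts X f" "\<And>g v. P g v \<Longrightarrow> (\<And>x. x \<in> topspace X \<Longrightarrow> g x \<le> f x) \<Longrightarrow> v \<le> b"
  shows "lower_extension X P f \<le> b"
proof -
  obtain B where B: "\<And>x. x \<in> topspace X \<Longrightarrow> \<bar>f x\<bar> \<le> B"
    using cts_bounded[OF compact assms(1)] by metis
  have "\<forall>x\<in>topspace X. - B \<le> f x" using B by fastforce
  then have "{v. \<exists>g. P g v \<and> (\<forall>x\<in>topspace X. g x \<le> f x)} \<noteq> {}"
    using const[of "-B"] by blast
  then show ?thesis
    unfolding lower_extension_def using assms(2) by (intro cSup_least) auto
qed

text \<open>\<open>A\<close> and \<open>S\<close> each give one inequality. The reverse ones come
  from applying them to the translated function with \<open>- c\<close> and to the scaled function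
  with \<open>1/t\<close>, which leaves \<open>t = 0\<close> as a separate case.\<close>

lemma weak_functional_lower_extension: "weak_functional X (lower_extension X P)"
proof -
  let ?E = "lower_extension X P"
  have A: "?E f \<le> ?E (\<lambda>x. f x + c) - c" if f: "cts X f" for f c
  proof (rule least[OF f])
    fix g v assume g: "P g v" "\<And>x. x \<in> topspace X \<Longrightarrow> g x \<le> f x"
    have "v + c \<le> ?E (\<lambda>x. f x + c)"
      by (rule upper[OF _ add[OF g(1)]]) (use f g(2) in \<open>auto intro!: continuous_intros\<close>)
    then show "v \<le> ?E (\<lambda>x. f x + c) - c" by simp
  qed
  have S: "?E f \<le> ?E (\<lambda>x. t * f x) / t" if f: "cts X f" "t > 0" for f t
  proof (rule least[OF f(1)])
    fix g v assume g: "P g v" "\<And>x. x \<in> topspace X \<Longrightarrow> g x \<le> f x"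
    have "t * v \<le> ?E (\<lambda>x. t * f x)"
      by (rule upper[OF _ scale[OF g(1)]]) (use f g(2) in \<open>auto intro!: continuous_intros\<close>)
    then show "v \<le> ?E (\<lambda>x. t * f x) / t" using f by (simp add: field_simps)
  qed
  show ?thesis
  proof (rule weak_functionalI)
    fix f :: "'a \<Rightarrow> real" and c assume f: "cts X f"
    have "?E (\<lambda>x. f x + c) \<le> ?E f + c"
      using A[of "\<lambda>x. f x + c" "-c"] f by (simp add: continuous_map_add)
    then show "?E (\<lambda>x. f x + c) = ?E f + c" using A[OF f, of c] by simp
  next
    fix f g :: "'a \<Rightarrow> real"
    assume f: "cts X f" "cts X g" "\<And>x. x \<in> topspace X \<Longrightarrow> f x \<le> g x"
    show "?E f \<le> ?E g"
    proof (rule least[OF f(1)])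
      fix h v assume "P h v" "\<And>x. x \<in> topspace X \<Longrightarrow> h x \<le> f x"
      then show "v \<le> ?E g" using upper[OF f(2)] f(3) order_trans by meson
    qed
  next
    fix f :: "'a \<Rightarrow> real" and t::real assume f: "cts X f" "t \<ge> 0"
    show "?E (\<lambda>x. t * f x) = t * ?E f"
    proof (cases "t = 0")
      case True
      have "?E (\<lambda>x. 0) = 0"
        by (intro antisym least upper[OF _ const[of 0]]) (auto intro: bound)
      then show ?thesis using True by simp
    next
      case False
      then have "t > 0" using f by simp
      have "?E (\<lambda>x. t * f x) \<le> ?E (\<lambda>x. (1/t) * (t * f x)) / (1/t)"
        using \<open>t > 0\<close> f by (intro S) (auto intro!: continuous_intros)
      also have "\<dots> = t * ?E f" using \<open>t > 0\<close> by (simp add: mult.commute)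
      finally show ?thesis using S[OF f(1) \<open>t > 0\<close>] \<open>t > 0\<close> by (simp add: field_simps)
    qed
  qed
qed

end

section \<open>The space of functionals\<close>

lemma restrict_in_Cfun: "cts X f \<Longrightarrow> restrict f (topspace X) \<in> Cfun X"
  by (auto simp: Cfun_def intro: continuous_map_eq)

lemma CfunD: "f \<in> Cfun X \<Longrightarrow> cts X f" "f \<in> Cfun X \<Longrightarrow> restrict f (topspace X) = f"
  by (auto simp: Cfun_def)

lemma ev_Cfun: "f \<in> Cfun X \<Longrightarrow> ev X \<nu> f = \<nu> f"
  by (simp add: ev_def CfunD)

lemma is_OH_iff_weak_functional: "is_OH X \<nu> \<longleftrightarrow> weak_functional X (ev X \<nu>)"
proof
  assume H: "is_OH X \<nu>"
  show "weak_functional X (ev X \<nu>)"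
  proof (rule weak_functionalI)
    fix f :: "'a \<Rightarrow> real" and c assume f: "cts X f"
    have "restrict (\<lambda>x. f x + c) (topspace X) = restrict (\<lambda>x. restrict f (topspace X) x + c) (topspace X)"
      by auto
    then show "ev X \<nu> (\<lambda>x. f x + c) = ev X \<nu> f + c"
      unfolding ev_def using H restrict_in_Cfun[OF f] unfolding is_OH_def by presburger
  next
    fix f :: "'a \<Rightarrow> real" and t::real assume f: "cts X f" "t \<ge> 0"
    have "restrict (\<lambda>x. t * f x) (topspace X) = restrict (\<lambda>x. t * restrict f (topspace X) x) (topspace X)"
      by auto
    then show "ev X \<nu> (\<lambda>x. t * f x) = t * ev X \<nu> f"
      unfolding ev_def using H restrict_in_Cfun[OF f(1)] f(2) unfolding is_OH_def by presburger
  next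
    fix f g :: "'a \<Rightarrow> real"
    assume f: "cts X f" "cts X g" "\<And>x. x \<in> topspace X \<Longrightarrow> f x \<le> g x"
    then have "\<forall>x\<in>topspace X. restrict f (topspace X) x \<le> restrict g (topspace X) x"
      by simp
    then show "ev X \<nu> f \<le> ev X \<nu> g"
      unfolding ev_def using H restrict_in_Cfun[OF f(1)] restrict_in_Cfun[OF f(2)]
      unfolding is_OH_def by blast
  qed
next
  assume H: "weak_functional X (ev X \<nu>)"
  have "\<nu> (restrict (\<lambda>x. 1) (topspace X)) = 1"
    using weak_functional_const[OF H, of 1] by (simp add: ev_def)
  moreover have "\<nu> (restrict (\<lambda>x. f x + c) (topspace X)) = \<nu> f + c" if "f \<in> Cfun X" for f c
    using weak_functional_add[OF H CfunD(1)[OF that], of c] CfunD(2)[OF that] by (simp add: ev_def)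
  moreover have "\<nu> (restrict (\<lambda>x. t * f x) (topspace X)) = t * \<nu> f" if "f \<in> Cfun X" "t \<ge> 0" for f t
    using weak_functional_scale[OF H CfunD(1)[OF that(1)] that(2)] CfunD(2)[OF that(1)] by (simp add: ev_def)
  moreover have "\<nu> f \<le> \<nu> g" if "f \<in> Cfun X" "g \<in> Cfun X" "\<forall>x\<in>topspace X. f x \<le> g x" for f g
    using weak_functional_mono[OF H CfunD(1) CfunD(1), of f g] that by (simp add: ev_Cfun)
  ultimately show "is_OH X \<nu>"
    unfolding is_OH_def by blast
qed

text \<open>Comparing \<open>f\<close> with the constants inf f and sup f puts the value of a weak
  functional into the interval of the product.\<close>

lemma topspace_OH:
  assumes "compact_space X"
  shows "topspace (OH X) = {\<nu> \<in> extensional (Cfun X). weak_functional X (ev X \<nu>)}"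
proof -
  have "\<nu> f \<in> {Inf (f ` topspace X)..Sup (f ` topspace X)}"
    if H: "weak_functional X (ev X \<nu>)" and f: "f \<in> Cfun X" for \<nu> f
  proof -
    obtain B where B: "\<And>x. x \<in> topspace X \<Longrightarrow> \<bar>f x\<bar> \<le> B"
      using cts_bounded[OF assms CfunD(1)[OF f]] by metis
    have "bdd_above (f ` topspace X)" "bdd_below (f ` topspace X)"
      using B unfolding bdd_above_def bdd_below_def by (auto simp: abs_le_iff) (metis minus_le_iff)
    then have "ev X \<nu> f \<le> Sup (f ` topspace X)" "Inf (f ` topspace X) \<le> ev X \<nu> f"
      by (auto intro!: weak_functional_le_const[OF H] weak_functional_ge_const[OF H] cSUP_upper cINF_lower
          CfunD(1)[OF f])
    then show ?thesis
      by (simp add: ev_Cfun f)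
  qed
  then show ?thesis
    unfolding OH_def by (auto simp: is_OH_iff_weak_functional PiE_def)
qed

lemma OH_weak_functional: "\<nu> \<in> topspace (OH X) \<Longrightarrow> weak_functional X (ev X \<nu>)"
  unfolding OH_def by (auto simp: is_OH_iff_weak_functional)

lemma weak_functional_ev:
  assumes "weak_functional X V" "cts X f"
  shows "ev X (restrict V (Cfun X)) f = V f"
  using weak_functional_cong[OF assms(1) CfunD(1)[OF restrict_in_Cfun] assms(2)] assms restrict_in_Cfun
  by (auto simp: ev_def)

lemma weak_functional_in_OH:
  assumes "compact_space X" "weak_functional X V"
  shows "restrict V (Cfun X) \<in> topspace (OH X)"
proof -
  have "weak_functional X (ev X (restrict V (Cfun X)))"
    using assms(2)
    by (intro weak_functionalI)
      (simp_all add: weak_functional_ev weak_functional_add weak_functional_scale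
        weak_functional_mono continuous_map_add continuous_map_real_mult_left)
  then show ?thesis
    by (simp add: topspace_OH assms)
qed

lemma cts_OH_eval: "f \<in> Cfun X \<Longrightarrow> cts (OH X) (\<lambda>\<nu>. \<nu> f)"
proof -
  assume f: "f \<in> Cfun X"
  have "continuous_map (product_topology
        (\<lambda>\<phi>. subtopology euclideanreal {Inf (\<phi> ` topspace X) .. Sup (\<phi> ` topspace X)}) (Cfun X))
        (subtopology euclideanreal {Inf (f ` topspace X) .. Sup (f ` topspace X)}) (\<lambda>\<nu>. \<nu> f)"
    using continuous_map_product_projection[OF f] .
  then show ?thesis
    unfolding OH_def by (meson continuous_map_from_subtopology continuous_map_into_fulltopology)
qed

lemma cts_OH_ev: "cts X f \<Longrightarrow> cts (OH X) (\<lambda>\<nu>. ev X \<nu> f)"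
  unfolding ev_def by (intro cts_OH_eval restrict_in_Cfun)

section \<open>Compactness, basic neighbourhoods and uniform continuity\<close>

lemma closedin_Collect_Ball:
  assumes "\<And>i. i \<in> I \<Longrightarrow> closedin P {x \<in> topspace P. R i x}"
  shows "closedin P {x \<in> topspace P. \<forall>i\<in>I. R i x}"
proof -
  have "{x \<in> topspace P. \<forall>i\<in>I. R i x} = \<Inter> (insert (topspace P) ((\<lambda>i. {x \<in> topspace P. R i x}) ` I))"
    by auto
  also have "closedin P \<dots>"
    using assms by (intro closedin_Inter) auto
  finally show ?thesis .
qed

lemma closedin_Collect_real_le:
  assumes "cts P f" "cts P g"
  shows "closedin P {x \<in> topspace P. f x \<le> g x}"
proof -
  have "closedin P {x \<in> topspace P. f x - g x \<in> {..0}}"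
    using assms by (intro closedin_continuous_map_preimage[where Y=euclideanreal] continuous_intros) auto
  then show ?thesis by simp
qed

text \<open>Every instance of an axiom is an equation or inequality between finitely many
  coordinates, hence a closed condition in a product of compact intervals.\<close>

lemma compact_space_OH: "compact_space (OH X)"
proof -
  define P where "P = product_topology
        (\<lambda>\<phi>. subtopology euclideanreal {Inf (\<phi> ` topspace X) .. Sup (\<phi> ` topspace X)}) (Cfun X)"
  have "compact_space P"
    unfolding P_def by (auto simp: compact_space_product_topology intro!: compact_space_subtopology)
  have ct: "cts P (\<lambda>\<nu>. \<nu> (restrict f (topspace X)))" if "cts X f" for f
    unfolding P_def
    using continuous_map_into_fulltopology[OF continuous_map_product_projection[OF restrict_in_Cfun[OF that]]] .
  have ct': "cts P (\<lambda>\<nu>. \<nu> f)" if "f \<in> Cfun X" for f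
    using ct[OF CfunD(1)[OF that]] CfunD(2)[OF that] by simp
  note eqs = closedin_continuous_maps_eq[OF Hausdorff_space_euclidean]
  \<comment> \<open>All quantifiers and side conditions are written as bounded quantifiers, the form
    that \<open>closedin_Collect_Ball\<close> handles.\<close>
  have "{\<nu> \<in> topspace P. is_OH X \<nu>} =
     {\<nu> \<in> topspace P. \<nu> (restrict (\<lambda>x. 1) (topspace X)) = 1} \<inter>
     {\<nu> \<in> topspace P. \<forall>\<phi>\<in>Cfun X. \<forall>c\<in>UNIV. \<nu> (restrict (\<lambda>x. \<phi> x + c) (topspace X)) = \<nu> \<phi> + c} \<inter>
     {\<nu> \<in> topspace P. \<forall>\<phi>\<in>Cfun X. \<forall>\<psi>\<in>{\<psi>\<in>Cfun X. \<forall>x\<in>topspace X. \<phi> x \<le> \<psi> x}. \<nu> \<phi> \<le> \<nu> \<psi>} \<inter>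
     {\<nu> \<in> topspace P. \<forall>\<phi>\<in>Cfun X. \<forall>t\<in>{0..}. \<nu> (restrict (\<lambda>x. t * \<phi> x) (topspace X)) = t * \<nu> \<phi>}"
    unfolding is_OH_def by auto
  also have "closedin P \<dots>"
    by (intro closedin_Int closedin_Collect_Ball eqs closedin_Collect_real_le ct ct' continuous_intros)
      (auto intro: CfunD)
  finally have "compactin P {\<nu> \<in> topspace P. is_OH X \<nu>}"
    using \<open>compact_space P\<close> closedin_compact_space by blast
  then have "compact_space (subtopology P {\<nu> \<in> topspace P. is_OH X \<nu>})"
    by (rule compact_space_subtopology)
  moreover have "OH X = subtopology P {\<nu> \<in> topspace P. is_OH X \<nu>}"
    unfolding OH_def P_def[symmetric]
    by (metis Collect_conj_eq Collect_mem_eq subtopology_restrict)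
  ultimately show ?thesis by simp
qed

text \<open>A basic open set of the product constrains only finitely many coordinates, so the
  smallest of the finitely many radii serves for all of them.\<close>

lemma OH_basic_neighbourhood:
  assumes "openin (OH X) U" "\<nu> \<in> U"
  obtains F \<tau> where "finite F" "F \<subseteq> Cfun X" "\<tau> > 0"
    "\<And>\<nu>'. \<nu>' \<in> topspace (OH X) \<Longrightarrow> (\<And>f. f \<in> F \<Longrightarrow> \<bar>\<nu>' f - \<nu> f\<bar> < \<tau>) \<Longrightarrow> \<nu>' \<in> U"
proof -
  define Y where "Y = (\<lambda>\<phi>::'a\<Rightarrow>real. subtopology euclideanreal {Inf (\<phi> ` topspace X) .. Sup (\<phi> ` topspace X)})"
  obtain W where W: "openin (product_topology Y (Cfun X)) W" "U = W \<inter> {\<nu>. is_OH X \<nu>}"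
    using assms(1) unfolding OH_def Y_def[symmetric] openin_subtopology by blast
  have "\<nu> \<in> W" using W(2) assms(2) by simp
  from bspec[OF W(1)[unfolded openin_product_topology_alt] this]
  obtain A where A: "finite {i \<in> Cfun X. A i \<noteq> topspace (Y i)}"
      "\<And>i. i \<in> Cfun X \<Longrightarrow> openin (Y i) (A i)" "\<nu> \<in> Pi\<^sub>E (Cfun X) A" "Pi\<^sub>E (Cfun X) A \<subseteq> W"
    by blast
  define F where "F = {i \<in> Cfun X. A i \<noteq> topspace (Y i)}"
  have "\<exists>\<tau>>0. \<forall>y\<in>topspace (Y f). \<bar>y - \<nu> f\<bar> < \<tau> \<longrightarrow> y \<in> A f" if "f \<in> F" for f
  proof -
    have f: "f \<in> Cfun X" using that by (simp add: F_def)
    obtain O' where O': "open O'" "A f = O' \<inter> topspace (Y f)"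
      using A(2)[OF f] by (auto simp: Y_def openin_subtopology)
    have "\<nu> f \<in> O'" using A(3) f O' by auto
    then obtain e where "e > 0" "\<forall>y. dist y (\<nu> f) < e \<longrightarrow> y \<in> O'"
      using O'(1) by (metis open_dist)
    then show ?thesis using O'(2) by (auto simp: dist_real_def)
  qed
  then obtain t where t: "\<And>f. f \<in> F \<Longrightarrow> t f > 0"
      "\<And>f y. f \<in> F \<Longrightarrow> y \<in> topspace (Y f) \<Longrightarrow> \<bar>y - \<nu> f\<bar> < t f \<Longrightarrow> y \<in> A f"
    by metis
  have "finite F" using A(1) by (simp add: F_def)
  \<comment> \<open>The inserted 1 keeps the minimum meaningful when \<open>F\<close> is
    empty.\<close>
  define \<tau> where "\<tau> = Min (insert 1 (t ` F))"
  have "\<tau> > 0" "\<And>f. f \<in> F \<Longrightarrow> \<tau> \<le> t f"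
    using \<open>finite F\<close> t(1) by (auto simp: \<tau>_def)
  show ?thesis
  proof (rule that[OF \<open>finite F\<close> _ \<open>\<tau> > 0\<close>])
    show "F \<subseteq> Cfun X" by (auto simp: F_def)
    fix \<nu>' assume \<nu>': "\<nu>' \<in> topspace (OH X)" "\<And>f. f \<in> F \<Longrightarrow> \<bar>\<nu>' f - \<nu> f\<bar> < \<tau>"
    have p: "\<nu>' \<in> Pi\<^sub>E (Cfun X) (\<lambda>i. topspace (Y i))" "is_OH X \<nu>'"
      using \<nu>'(1) unfolding OH_def Y_def[symmetric] by auto
    have "\<nu>' f \<in> A f" if "f \<in> Cfun X" for f
    proof (cases "f \<in> F")
      case True
      then show ?thesis
        using t(2)[OF True] p(1) that \<nu>'(2)[OF True] \<open>\<And>f. f \<in> F \<Longrightarrow> \<tau> \<le> t f\<close>[OF True] by fastforce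
    next
      case False
      then show ?thesis using that p(1) by (auto simp: F_def)
    qed
    then have "\<nu>' \<in> Pi\<^sub>E (Cfun X) A" using p(1) by (auto simp: PiE_def)
    then show "\<nu>' \<in> U" using A(4) W(2) p(2) by blast
  qed
qed

lemma openin_OH_basic:
  assumes "finite F" "F \<subseteq> Cfun X"
  shows "openin (OH X) {\<nu>' \<in> topspace (OH X). \<forall>f\<in>F. \<bar>\<nu>' f - \<nu> f\<bar> < \<tau>}"
proof -
  have o: "openin (OH X) {\<nu>' \<in> topspace (OH X). \<bar>\<nu>' f - \<nu> f\<bar> < \<tau>}" if "f \<in> F" for f
  proof -
    have "openin (OH X) {\<nu>' \<in> topspace (OH X). \<bar>\<nu>' f - \<nu> f\<bar> \<in> {..<\<tau>}}"
      using assms that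
      by (intro openin_continuous_map_preimage[where Y=euclideanreal] continuous_intros cts_OH_eval) auto
    then show ?thesis by simp
  qed
  have "{\<nu>' \<in> topspace (OH X). \<forall>f\<in>F. \<bar>\<nu>' f - \<nu> f\<bar> < \<tau>} =
      \<Inter> (insert (topspace (OH X)) ((\<lambda>f. {\<nu>' \<in> topspace (OH X). \<bar>\<nu>' f - \<nu> f\<bar> < \<tau>}) ` F))"
    by auto
  also have "openin (OH X) \<dots>"
    using assms o by (intro openin_Inter) auto
  finally show ?thesis .
qed

text \<open>A Lebesgue number argument: finitely many neighbourhoods of half radius cover the space.
  A point within \<tau>/2 of a centre that moves by at most \<tau>/4 stays within \<tau> of it, and
  \<Phi> is compared with its value at the centre twice, at cost e/2 each.\<close>

lemma OH_uniform_continuity: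
  assumes \<Phi>: "cts (OH X) \<Phi>" and "e > 0"
  obtains F \<tau> where "finite F" "F \<subseteq> Cfun X" "\<tau> > 0"
    "\<And>\<nu> \<nu>'. \<nu> \<in> topspace (OH X) \<Longrightarrow> \<nu>' \<in> topspace (OH X) \<Longrightarrow>
      (\<And>f. f \<in> F \<Longrightarrow> \<bar>\<nu>' f - \<nu> f\<bar> \<le> \<tau>) \<Longrightarrow> \<bar>\<Phi> \<nu>' - \<Phi> \<nu>\<bar> < e"
proof -
  have "\<exists>F \<tau>. finite F \<and> F \<subseteq> Cfun X \<and> \<tau> > 0 \<and> (\<forall>\<nu>'\<in>topspace (OH X).
      (\<forall>f\<in>F. \<bar>\<nu>' f - \<nu> f\<bar> < \<tau>) \<longrightarrow> \<bar>\<Phi> \<nu>' - \<Phi> \<nu>\<bar> < e/2)" if "\<nu> \<in> topspace (OH X)" for \<nu>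
  proof -
    have "openin (OH X) {\<nu>' \<in> topspace (OH X). \<bar>\<Phi> \<nu>' - \<Phi> \<nu>\<bar> \<in> {..<e/2}}"
      using \<Phi> by (intro openin_continuous_map_preimage[where Y=euclideanreal] continuous_intros) auto
    from OH_basic_neighbourhood[OF this, of \<nu>] show ?thesis
      using that \<open>e > 0\<close> by (smt (verit, best) lessThan_iff mem_Collect_eq half_gt_zero)
  qed
  then obtain F \<tau> where F: "\<And>\<nu>. \<nu> \<in> topspace (OH X) \<Longrightarrow> finite (F \<nu>)"
     "\<And>\<nu>. \<nu> \<in> topspace (OH X) \<Longrightarrow> F \<nu> \<subseteq> Cfun X"
     "\<And>\<nu>. \<nu> \<in> topspace (OH X) \<Longrightarrow> \<tau> \<nu> > (0::real)"
     "\<And>\<nu> \<nu>'. \<nu> \<in> topspace (OH X) \<Longrightarrow> \<nu>' \<in> topspace (OH X) \<Longrightarrow>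
       \<forall>f\<in>F \<nu>. \<bar>\<nu>' f - \<nu> f\<bar> < \<tau> \<nu> \<Longrightarrow> \<bar>\<Phi> \<nu>' - \<Phi> \<nu>\<bar> < e/2"
    by metis
  define W where "W = (\<lambda>\<nu>. {\<nu>' \<in> topspace (OH X). \<forall>f\<in>F \<nu>. \<bar>\<nu>' f - \<nu> f\<bar> < \<tau> \<nu> / 2})"
  have "\<exists>G. finite G \<and> G \<subseteq> W ` topspace (OH X) \<and> topspace (OH X) \<subseteq> \<Union>G"
  proof (rule compact_space_OH[unfolded compact_space_def, THEN compactinD])
    show "openin (OH X) U" if "U \<in> W ` topspace (OH X)" for U
      using that F(1,2) openin_OH_basic unfolding W_def by blast
    show "topspace (OH X) \<subseteq> \<Union> (W ` topspace (OH X))"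
      using F(3) by (auto simp: W_def)
  qed
  then obtain N where N: "finite N" "N \<subseteq> topspace (OH X)" "topspace (OH X) \<subseteq> \<Union> (W ` N)"
    by (metis finite_subset_image)
  define t where "t = Min (insert 1 ((\<lambda>\<nu>. \<tau> \<nu> / 4) ` N))"
  have t: "t > 0" "\<And>\<nu>. \<nu> \<in> N \<Longrightarrow> t \<le> \<tau> \<nu> / 4"
    unfolding t_def using N F(3) by (auto simp: subset_iff intro!: Min_le simp del: le_divide_eq_numeral1)
  show ?thesis
  proof (rule that[of "\<Union> (F ` N)" t])
    fix \<nu> \<nu>' assume \<nu>: "\<nu> \<in> topspace (OH X)" "\<nu>' \<in> topspace (OH X)"
      and c: "\<And>f. f \<in> \<Union> (F ` N) \<Longrightarrow> \<bar>\<nu>' f - \<nu> f\<bar> \<le> t"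
    obtain \<kappa> where \<kappa>: "\<kappa> \<in> N" "\<nu> \<in> W \<kappa>" using N(3) \<nu> by blast
    have \<kappa>t: "\<kappa> \<in> topspace (OH X)" using \<kappa> N by blast
    have w: "\<And>f. f \<in> F \<kappa> \<Longrightarrow> \<bar>\<nu> f - \<kappa> f\<bar> < \<tau> \<kappa> / 2" using \<kappa>(2) by (auto simp: W_def)
    have "\<bar>\<Phi> \<nu> - \<Phi> \<kappa>\<bar> < e/2"
      using F(3)[OF \<kappa>t] w by (intro F(4)[OF \<kappa>t \<nu>(1)]) fastforce
    moreover have "\<bar>\<Phi> \<nu>' - \<Phi> \<kappa>\<bar> < e/2"
    proof (intro F(4)[OF \<kappa>t \<nu>(2)] ballI)
      fix f assume f: "f \<in> F \<kappa>"
      then have "\<bar>\<nu>' f - \<nu> f\<bar> \<le> t"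
        using c \<kappa>(1) by blast
      then show "\<bar>\<nu>' f - \<kappa> f\<bar> < \<tau> \<kappa>"
        using w[OF f] t(2)[OF \<kappa>(1)] F(3)[OF \<kappa>t] by linarith
    qed
    ultimately show "\<bar>\<Phi> \<nu>' - \<Phi> \<nu>\<bar> < e" by linarith
  qed (use N F(1,2) t in \<open>blast+\<close>)
qed

section \<open>Finite dominating families\<close>

lemma weak_functional_point: "x \<in> topspace X \<Longrightarrow> weak_functional X (\<lambda>f. f x)"
  by (rule weak_functionalI) auto

text \<open>Truncating \<open>\<phi>\<close> at \<open>- M\<close> may increase its value from \<open>V \<phi>\<close> to \<open>c\<close>; the functional \<open>W\<close> gives
  \<open>\<phi>\<close> this value although it hardly differs from \<open>V\<close> on functions of small oscillation compared to
  \<open>M\<close>.\<close>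

lemma raise_truncated_value:
  assumes X: "compact_space X" and V: "weak_functional X V" and \<phi>: "cts X \<phi>"
    and B: "0 < B" "B < M" "\<And>x. x \<in> topspace X \<Longrightarrow> \<phi> x \<le> B"
    and c: "c = V (\<lambda>x. max (\<phi> x) (- M))" "- B < c"
  obtains W where "weak_functional X W" "c \<le> W \<phi>"
    "\<And>\<psi> p S. cts X \<psi> \<Longrightarrow> (\<And>x. x \<in> topspace X \<Longrightarrow> p \<le> \<psi> x \<and> \<psi> x \<le> p + S) \<Longrightarrow>
       V \<psi> \<le> W \<psi> \<and> W \<psi> \<le> V \<psi> + 2 * B * S / (M - B)"
proof -
  \<comment> \<open>The affine images of \<phi> with nonnegative slope are the least family that
    contains \<phi> with value \<open>c\<close> and is closed under translation and scaling.\<close>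
  define P where "P = (\<lambda>g v. \<exists>a d. d \<ge> 0 \<and> g = (\<lambda>x. a + d * \<phi> x) \<and> v = a + d * c)"
  have ct: "cts X (\<lambda>x. max (\<phi> x) (- M))"
    using \<phi> by (intro continuous_intros) auto
  \<comment> \<open>This is what \<open>bound\<close> needs: truncation raises the supremum of
    \<phi> at most to \<open>- M\<close>, and \<open>c > - B > - M\<close> excludes that this
    matters.\<close>
  have c_le: "c \<le> b" if "\<And>x. x \<in> topspace X \<Longrightarrow> \<phi> x \<le> b" for b
  proof -
    have "c \<le> max b (- M)"
      unfolding c(1) by (rule weak_functional_le_const[OF V ct]) (use that in fastforce)
    then show ?thesis using c(2) B by linarith
  qed
  have X_ne: "topspace X \<noteq> {}" by (rule weak_functional_nonempty[OF V])
  interpret extension_data X P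
  proof
    show "\<exists>g v. P g v" unfolding P_def by (metis order_refl)
  next
    fix g v k assume "P g v"
    then obtain a d where "d \<ge> 0" "g = (\<lambda>x. a + d * \<phi> x)" "v = a + d * c" unfolding P_def by blast
    then show "P (\<lambda>x. g x + k) (v + k)"
      unfolding P_def by (intro exI[of _ "a + k"] exI[of _ d]) auto
  next
    fix g v and t :: real assume "P g v" "t \<ge> 0"
    then obtain a d where "d \<ge> 0" "g = (\<lambda>x. a + d * \<phi> x)" "v = a + d * c" unfolding P_def by blast
    then show "P (\<lambda>x. t * g x) (t * v)"
      unfolding P_def using \<open>t \<ge> 0\<close> by (intro exI[of _ "t * a"] exI[of _ "t * d"]) (auto simp: algebra_simps)
  next
    fix g v b assume "P g v" and b: "\<And>x. x \<in> topspace X \<Longrightarrow> g x \<le> b"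
    then obtain a d where d: "d \<ge> 0" "g = (\<lambda>x. a + d * \<phi> x)" "v = a + d * c" unfolding P_def by blast
    show "v \<le> b"
    proof (cases "d = 0")
      case True
      then show ?thesis using d b X_ne by fastforce
    next
      case False
      then have "d > 0" using d by simp
      have "c \<le> (b - a) / d"
        by (rule c_le) (use b d \<open>d > 0\<close> in \<open>auto simp: field_simps\<close>)
      then show ?thesis using \<open>d > 0\<close> d by (simp add: field_simps)
    qed
  qed (rule X)
  let ?w = "lower_extension X P"
  obtain x0 where x0: "x0 \<in> topspace X" "\<And>x. x \<in> topspace X \<Longrightarrow> \<phi> x \<le> \<phi> x0"
    using cts_attains_max[OF X \<phi> X_ne] by blast
  define \<beta> where "\<beta> = \<phi> x0"
  have \<beta>: "c \<le> \<beta>" "\<beta> \<le> B" using c_le x0 B by (auto simp: \<beta>_def)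
  have close: "?w \<psi> \<le> V \<psi> + 2 * B * S / (M - B)"
    if \<psi>: "cts X \<psi>" and bd: "\<And>x. x \<in> topspace X \<Longrightarrow> p \<le> \<psi> x \<and> \<psi> x \<le> p + S" for \<psi> p S
  proof (rule least[OF \<psi>])
    fix g v assume "P g v" and g: "\<And>x. x \<in> topspace X \<Longrightarrow> g x \<le> \<psi> x"
    then obtain a d where d: "d \<ge> 0" "g = (\<lambda>x. a + d * \<phi> x)" "v = a + d * c" unfolding P_def by blast
    have "S \<ge> 0" using bd[OF x0(1)] by linarith
    then have nn: "0 \<le> 2 * B * S / (M - B)" using B by simp
    \<comment> \<open>By the choice of \<open>c\<close>, an affine function of the truncated \<phi>
      has the same \<open>V\<close>-value as the prescription for \<phi> itself. It remains to push
      such a function below \<psi>.\<close>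
    have le: "a' + d' * c \<le> V \<psi>"
      if "d' \<ge> 0" "\<And>x. x \<in> topspace X \<Longrightarrow> a' + d' * max (\<phi> x) (- M) \<le> \<psi> x" for a' d'
    proof -
      have "a' + d' * c = V (\<lambda>x. a' + d' * max (\<phi> x) (- M))"
        unfolding c(1) by (rule weak_functional_affine[OF V ct that(1), symmetric])
      also have "\<dots> \<le> V \<psi>"
        using that(2)
        by (intro weak_functional_mono[OF V] continuous_map_add continuous_map_real_mult_left ct \<psi>) auto
      finally show ?thesis .
    qed
    show "v \<le> V \<psi> + 2 * B * S / (M - B)"
    proof (cases "a - d * M \<le> p")
      \<comment> \<open>Where \<phi> is truncated, the line has the value \<open>a - d * M\<close>,
        which here is at most the lower bound \<open>p\<close> of \<psi>.\<close>
      case True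
      have "a + d * max (\<phi> x) (- M) \<le> \<psi> x" if x: "x \<in> topspace X" for x
        using True g[OF x] bd[OF x] d by (auto simp: max_def)
      then have "a + d * c \<le> V \<psi>" using le d(1) by blast
      then show ?thesis using nn d(3) by linarith
    next
      case False
      have M\<beta>: "M + \<beta> > 0" "M - B \<le> M + \<beta>" using \<beta> c B by linarith+
      \<comment> \<open>The steeper line through \<open>(\<beta>, a + d \<beta>)\<close> and \<open>(- M, p)\<close> stays below \<open>\<psi>\<close> also where
        \<open>\<phi>\<close> is truncated; its slope is small because \<open>M\<close> is large.\<close>
      define d' where "d' = (a + d * \<beta> - p) / (M + \<beta>)"
      have d'M: "d' * (M + \<beta>) = a + d * \<beta> - p" using M\<beta> by (simp add: d'_def)
      have "d * (M + \<beta>) \<le> d' * (M + \<beta>)" unfolding d'M using False by (simp add: algebra_simps)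
      then have dd: "d \<le> d'" using M\<beta> by simp
      have "a + d * \<beta> - d' * \<beta> + d' * max (\<phi> x) (- M) \<le> \<psi> x" if x: "x \<in> topspace X" for x
      proof (cases "\<phi> x \<ge> - M")
        case True
        have "d * (\<beta> - \<phi> x) \<le> d' * (\<beta> - \<phi> x)"
          using dd x0(2)[OF x] by (intro mult_right_mono) (auto simp: \<beta>_def)
        then show ?thesis using True g[OF x] d by (simp add: max_def algebra_simps)
      next
        case False
        then have "a + d * \<beta> - d' * \<beta> + d' * max (\<phi> x) (- M) = a + d * \<beta> - d' * (M + \<beta>)"
          by (simp add: max_def algebra_simps)
        also have "\<dots> = p" unfolding d'M by simp
        finally show ?thesis using bd[OF x] by simp
      qed
      then have l: "a + d * \<beta> - d' * \<beta> + d' * c \<le> V \<psi>"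
        using le[of d'] dd d(1) by fastforce
      have "a + d * \<beta> \<le> p + S"
        using g[OF x0(1)] bd[OF x0(1)] d by (simp add: \<beta>_def)
      then have "d' \<le> S / (M + \<beta>)"
        using M\<beta> by (simp add: d'_def divide_right_mono)
      also have "\<dots> \<le> S / (M - B)"
        using M\<beta> B \<open>S \<ge> 0\<close> by (intro divide_left_mono) auto
      finally have d'S: "d' \<le> S / (M - B)" .
      \<comment> \<open>This is the amount lost at height \<open>c\<close> by tilting the line about
        \<beta>; the bounds \<beta> \<le> B and c > - B give the factor
        \<open>2 * B\<close>.\<close>
      have "(d' - d) * (\<beta> - c) \<le> S / (M - B) * (2 * B)"
        using d'S d(1) \<beta> c dd B \<open>S \<ge> 0\<close> by (intro mult_mono) auto
      then show ?thesis using l d(3) by (simp add: algebra_simps)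
    qed
  qed
  show ?thesis
  \<comment> \<open>Taking the maximum with \<open>V\<close> ensures
    \<open>V \<psi> \<le> W \<psi>\<close>; the other estimate is \<open>close\<close>.\<close>
  proof (rule that[OF weak_functional_max[OF V weak_functional_lower_extension]])
    have "c \<le> ?w \<phi>"
    proof (rule upper[OF \<phi>, of \<phi>])
      show "P \<phi> c" unfolding P_def by (intro exI[of _ 0] exI[of _ 1]) auto
    qed simp
    then show "c \<le> max (V \<phi>) (?w \<phi>)" by simp
    fix \<psi> p S assume "cts X \<psi>" and bd: "\<And>x. x \<in> topspace X \<Longrightarrow> p \<le> \<psi> x \<and> \<psi> x \<le> p + S"
    have "S \<ge> 0" using bd[OF x0(1)] by linarith
    then have nn: "0 \<le> 2 * B * S / (M - B)" using B by simp
    show "V \<psi> \<le> max (V \<psi>) (?w \<psi>) \<and> max (V \<psi>) (?w \<psi>) \<le> V \<psi> + 2 * B * S / (M - B)"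
      using close[OF \<open>cts X \<psi>\<close> bd] nn by auto
  qed
qed

lemma finite_cts_bounded:
  assumes "compact_space X" "finite F" "F \<subseteq> Cfun X"
  obtains S where "S > 0" "\<And>f x. f \<in> F \<Longrightarrow> x \<in> topspace X \<Longrightarrow> \<bar>f x\<bar> \<le> S"
proof -
  have "\<exists>b. \<forall>x\<in>topspace X. \<bar>f x\<bar> \<le> b" if "f \<in> F" for f
    using cts_bounded[OF assms(1), of f] assms(3) CfunD(1) that by (metis subsetD)
  then obtain b where b: "\<And>f x. f \<in> F \<Longrightarrow> x \<in> topspace X \<Longrightarrow> \<bar>f x\<bar> \<le> b f"
    by metis
  show ?thesis
  proof (rule that[of "Max (insert 1 (b ` F))"])
    show "0 < Max (insert 1 (b ` F))" using assms(2) by (simp add: Max_gr_iff)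
    fix f x assume "f \<in> F" "x \<in> topspace X"
    moreover from this have "b f \<le> Max (insert 1 (b ` F))" using assms(2) by (intro Max_ge) auto
    ultimately show "\<bar>f x\<bar> \<le> Max (insert 1 (b ` F))" using b by fastforce
  qed
qed

text \<open>If truncation raises the value of \<phi> at \<nu>, then
  \<open>raise_truncated_value\<close> supplies a functional close to \<nu> on \<open>F\<close> that
  gives \<phi> itself at least the raised value. There
  \<open>\<pi>\<^sub>\<phi> \<le> \<Phi>\<close> applies, and uniform continuity returns to \<nu> at
  cost e.\<close>

lemma OH_truncation:
  assumes X: "compact_space X" and \<Phi>: "cts (OH X) \<Phi>" and "e > 0"
  obtains M where "M > 0"
    "\<And>\<phi> x. cts X \<phi> \<Longrightarrow> (\<And>\<nu>. \<nu> \<in> topspace (OH X) \<Longrightarrow> ev X \<nu> \<phi> \<le> \<Phi> \<nu>) \<Longrightarrow> x \<in> topspace X \<Longrightarrow> \<phi> x \<le> M"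
    "\<And>\<phi> \<nu>. cts X \<phi> \<Longrightarrow> (\<And>\<nu>. \<nu> \<in> topspace (OH X) \<Longrightarrow> ev X \<nu> \<phi> \<le> \<Phi> \<nu>) \<Longrightarrow> \<nu> \<in> topspace (OH X) \<Longrightarrow>
       ev X \<nu> (\<lambda>x. max (\<phi> x) (- M)) \<le> \<Phi> \<nu> + e"
proof -
  obtain F \<tau> where F: "finite F" "F \<subseteq> Cfun X" "\<tau> > 0"
    "\<And>\<nu> \<nu>'. \<nu> \<in> topspace (OH X) \<Longrightarrow> \<nu>' \<in> topspace (OH X) \<Longrightarrow>
      (\<And>f. f \<in> F \<Longrightarrow> \<bar>\<nu>' f - \<nu> f\<bar> \<le> \<tau>) \<Longrightarrow> \<bar>\<Phi> \<nu>' - \<Phi> \<nu>\<bar> < e"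
    using OH_uniform_continuity[OF \<Phi> \<open>e > 0\<close>] by blast
  obtain S where S: "S > 0" "\<And>f x. f \<in> F \<Longrightarrow> x \<in> topspace X \<Longrightarrow> \<bar>f x\<bar> \<le> S"
    using finite_cts_bounded[OF X F(1,2)] by blast
  obtain B where B: "B > 0" "\<And>\<nu>. \<nu> \<in> topspace (OH X) \<Longrightarrow> \<bar>\<Phi> \<nu>\<bar> \<le> B"
    using cts_bounded[OF compact_space_OH \<Phi>] by blast
  \<comment> \<open>The functions in \<open>F\<close> oscillate by at most \<open>2 * S\<close>;
    \<open>M\<close> makes the error of \<open>raise_truncated_value\<close> for this oscillation
    exactly \<tau>.\<close>
  define M where "M = B + 2 * B * (2 * S) / \<tau>"
  have MB: "B < M" "2 * B * (2 * S) / (M - B) = \<tau>"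
    using B S F(3) by (auto simp: M_def)
  have le_B: "\<phi> x \<le> B"
    if \<phi>: "cts X \<phi>" "\<And>\<nu>. \<nu> \<in> topspace (OH X) \<Longrightarrow> ev X \<nu> \<phi> \<le> \<Phi> \<nu>" and x: "x \<in> topspace X" for \<phi> x
  proof -
    \<comment> \<open>The Dirac functional at \<open>x\<close> turns the bound on \<Phi> into a
      pointwise bound on \<phi>.\<close>
    let ?d = "restrict (\<lambda>f. f x) (Cfun X)"
    have "?d \<in> topspace (OH X)"
      by (rule weak_functional_in_OH[OF X weak_functional_point[OF x]])
    moreover have "ev X ?d \<phi> = \<phi> x"
      by (rule weak_functional_ev[OF weak_functional_point[OF x] \<phi>(1)])
    ultimately show ?thesis using \<phi>(2)[of ?d] B(2)[of ?d] by linarith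
  qed
  show ?thesis
  proof (rule that[of M])
    fix \<phi> \<nu> assume \<phi>: "cts X \<phi>" "\<And>\<nu>. \<nu> \<in> topspace (OH X) \<Longrightarrow> ev X \<nu> \<phi> \<le> \<Phi> \<nu>"
      and \<nu>: "\<nu> \<in> topspace (OH X)"
    define c where "c = ev X \<nu> (\<lambda>x. max (\<phi> x) (- M))"
    have "c \<le> \<Phi> \<nu> + e"
    proof (cases "- B < c")
      case False
      then show ?thesis using B(2)[OF \<nu>] \<open>e > 0\<close> by linarith
    next
      case True
      obtain W where W: "weak_functional X W" "c \<le> W \<phi>"
        "\<And>\<psi> p S. cts X \<psi> \<Longrightarrow> (\<And>x. x \<in> topspace X \<Longrightarrow> p \<le> \<psi> x \<and> \<psi> x \<le> p + S) \<Longrightarrow>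
          ev X \<nu> \<psi> \<le> W \<psi> \<and> W \<psi> \<le> ev X \<nu> \<psi> + 2 * B * S / (M - B)"
        using raise_truncated_value[OF X OH_weak_functional[OF \<nu>] \<phi>(1) B(1) MB(1) le_B[OF \<phi>] c_def True]
        by blast
      let ?\<nu> = "restrict W (Cfun X)"
      have \<nu>': "?\<nu> \<in> topspace (OH X)" by (rule weak_functional_in_OH[OF X W(1)])
      have "\<bar>?\<nu> f - \<nu> f\<bar> \<le> \<tau>" if f: "f \<in> F" for f
      proof -
        have fC: "f \<in> Cfun X" using f F by blast
        have "- S \<le> f x \<and> f x \<le> - S + 2 * S" if "x \<in> topspace X" for x
          using S(2)[OF f that] by linarith
        from W(3)[OF CfunD(1)[OF fC] this] show ?thesis
          unfolding MB(2) using fC by (simp add: ev_Cfun)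
      qed
      then have "\<Phi> ?\<nu> < \<Phi> \<nu> + e" using F(4)[OF \<nu> \<nu>'] by (simp add: abs_less_iff)
      moreover have "W \<phi> \<le> \<Phi> ?\<nu>"
        using \<phi>(2)[OF \<nu>'] weak_functional_ev[OF W(1) \<phi>(1)] by simp
      ultimately show ?thesis using W(2) by linarith
    qed
    then show "ev X \<nu> (\<lambda>x. max (\<phi> x) (- M)) \<le> \<Phi> \<nu> + e" by (simp add: c_def)
  qed (use MB B le_B in \<open>force+\<close>)
qed

section \<open>Local suprema and partitions of unity\<close>

lemma cts_bdd_above:
  assumes "compact_space X" "cts X f" "A \<subseteq> topspace X"
  shows "bdd_above (f ` A)"
proof -
  obtain B where "\<And>x. x \<in> topspace X \<Longrightarrow> \<bar>f x\<bar> \<le> B"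
    using cts_bounded[OF assms(1,2)] by blast
  then have "\<And>x. x \<in> A \<Longrightarrow> f x \<le> B" using assms(3) by (fastforce simp: abs_le_iff)
  then show ?thesis by (auto simp: bdd_above_def)
qed

text \<open>These suprema become the coefficients of the finite-dimensional majorants. As for
  \<open>lower_extension\<close>, equality comes from applying one inequality to the inverse
  translation or scaling.\<close>

lemma weak_functional_SUP:
  assumes X: "compact_space X" and A: "A \<subseteq> topspace X" "A \<noteq> {}"
  shows "weak_functional X (\<lambda>f. Sup (f ` A))"
proof -
  have bdd: "bdd_above (f ` A)" if "cts X f" for f
    by (rule cts_bdd_above[OF X that A(1)])
  have up: "f x \<le> Sup (f ` A)" if "cts X f" "x \<in> A" for f x
    by (rule cSUP_upper[OF that(2) bdd[OF that(1)]])
  have ad: "Sup ((\<lambda>x. f x + c) ` A) \<le> Sup (f ` A) + c" if "cts X f" for f c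
    using A up[OF that] by (intro cSUP_least) auto
  have sc: "Sup ((\<lambda>x. t * f x) ` A) \<le> t * Sup (f ` A)" if "cts X f" "t \<ge> 0" for f t
    using A up[OF that(1)] that(2) by (intro cSUP_least) (auto intro: mult_left_mono)
  show ?thesis
  proof (rule weak_functionalI)
    fix f :: "'a \<Rightarrow> real" and c assume f: "cts X f"
    have "Sup (f ` A) \<le> Sup ((\<lambda>x. f x + c) ` A) - c"
      using ad[of "\<lambda>x. f x + c" "-c"] f by (simp add: continuous_map_add)
    then show "Sup ((\<lambda>x. f x + c) ` A) = Sup (f ` A) + c" using ad[OF f, of c] by simp
  next
    fix f g :: "'a \<Rightarrow> real"
    assume f: "cts X f" "cts X g" "\<And>x. x \<in> topspace X \<Longrightarrow> f x \<le> g x"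
    show "Sup (f ` A) \<le> Sup (g ` A)"
      using A f(3) by (intro cSUP_mono bdd f(2)) auto
  next
    fix f :: "'a \<Rightarrow> real" and t::real assume f: "cts X f" "t \<ge> 0"
    show "Sup ((\<lambda>x. t * f x) ` A) = t * Sup (f ` A)"
    proof (cases "t = 0")
      case True
      then show ?thesis using A by simp
    next
      case False
      then have "t > 0" using f by simp
      have "Sup (f ` A) = Sup ((\<lambda>x. (1/t) * (t * f x)) ` A)" using \<open>t > 0\<close> by simp
      also have "\<dots> \<le> (1/t) * Sup ((\<lambda>x. t * f x) ` A)"
        using \<open>t > 0\<close> f(1) by (intro sc continuous_map_real_mult_left) auto
      finally have "t * Sup (f ` A) \<le> Sup ((\<lambda>x. t * f x) ` A)"
        using \<open>t > 0\<close> by (simp add: field_simps)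
      then show ?thesis using sc[OF f] by simp
    qed
  qed
qed

text \<open>The bump at \<open>y\<close> is built from \<open>F\<close> itself: it is positive only
  where the total deviation of \<open>F\<close> from its values at \<open>y\<close> is below
  \<tau>/2, so two points of \<open>A y\<close> differ by at most \<tau>. Compactness leaves
  finitely many bumps, whose positive sum normalises them.\<close>

lemma small_oscillation_partition_of_unity:
  assumes X: "compact_space X" and F: "finite F" "F \<subseteq> Cfun X" and "\<tau> > 0"
  obtains Y :: "'a set" and \<rho> :: "'a \<Rightarrow> 'a \<Rightarrow> real" and A where
    "finite Y" "\<And>y. y \<in> Y \<Longrightarrow> cts X (\<rho> y)"
    "\<And>y x. y \<in> Y \<Longrightarrow> x \<in> topspace X \<Longrightarrow> 0 \<le> \<rho> y x"
    "\<And>x. x \<in> topspace X \<Longrightarrow> (\<Sum>y\<in>Y. \<rho> y x) = 1"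
    "\<And>y x. y \<in> Y \<Longrightarrow> x \<in> topspace X \<Longrightarrow> \<rho> y x \<noteq> 0 \<Longrightarrow> x \<in> A y"
    "\<And>y. y \<in> Y \<Longrightarrow> A y \<subseteq> topspace X \<and> A y \<noteq> {}"
    "\<And>y f x x'. y \<in> Y \<Longrightarrow> f \<in> F \<Longrightarrow> x \<in> A y \<Longrightarrow> x' \<in> A y \<Longrightarrow> \<bar>f x - f x'\<bar> \<le> \<tau>"
proof -
  define \<sigma> where "\<sigma> = (\<lambda>y x. max 0 (\<tau>/2 - (\<Sum>f\<in>F. \<bar>f x - f y\<bar>)))"
  define A where "A = (\<lambda>y. {x \<in> topspace X. \<sigma> y x > 0})"
  have ct: "cts X (\<sigma> y)" for y
    unfolding \<sigma>_def using F CfunD(1) by (intro continuous_intros) auto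
  have self: "y \<in> A y" if "y \<in> topspace X" for y
    using that \<open>\<tau> > 0\<close> by (simp add: A_def \<sigma>_def)
  have small: "\<bar>f x - f y\<bar> \<le> \<tau>/2" if "f \<in> F" "x \<in> A y" for f x y
  proof -
    have "\<bar>f x - f y\<bar> \<le> (\<Sum>f\<in>F. \<bar>f x - f y\<bar>)"
      using F(1) that(1) by (intro member_le_sum[where f="\<lambda>f. \<bar>f x - f y\<bar>"]) auto
    moreover have "(\<Sum>f\<in>F. \<bar>f x - f y\<bar>) < \<tau>/2" using that(2) by (auto simp: A_def \<sigma>_def)
    ultimately show ?thesis by linarith
  qed
  have "\<exists>G. finite G \<and> G \<subseteq> A ` topspace X \<and> topspace X \<subseteq> \<Union>G"
  proof (rule X[unfolded compact_space_def, THEN compactinD])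
    show "openin X U" if U: "U \<in> A ` topspace X" for U
    proof -
      obtain y where y: "U = A y" using U by blast
      have "openin X {x \<in> topspace X. \<sigma> y x \<in> {0<..}}"
        by (rule openin_continuous_map_preimage[OF ct]) auto
      then show ?thesis by (simp add: y A_def)
    qed
    show "topspace X \<subseteq> \<Union> (A ` topspace X)" using self by blast
  qed
  then obtain Y where Y: "finite Y" "Y \<subseteq> topspace X" "topspace X \<subseteq> \<Union> (A ` Y)"
    by (metis finite_subset_image)
  define s where "s = (\<lambda>x. \<Sum>y\<in>Y. \<sigma> y x)"
  have nn: "0 \<le> \<sigma> y x" for y x by (simp add: \<sigma>_def)
  have s: "s x > 0" if x: "x \<in> topspace X" for x
  proof -
    obtain y where "y \<in> Y" "x \<in> A y" using Y(3) x by blast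
    then show ?thesis
      unfolding s_def using Y(1) nn by (intro sum_pos2[of Y y]) (auto simp: A_def)
  qed
  have cs: "cts X s" unfolding s_def using Y(1) ct by (intro continuous_intros) auto
  show ?thesis
  proof (rule that[of Y "\<lambda>y x. \<sigma> y x / s x" A])
    show "cts X (\<lambda>x. \<sigma> y x / s x)" for y
      using s by (intro continuous_map_real_divide ct cs) force
    show "0 \<le> \<sigma> y x / s x" if "x \<in> topspace X" for y x
      using nn s[OF that] by simp
    show "(\<Sum>y\<in>Y. \<sigma> y x / s x) = 1" if "x \<in> topspace X" for x
      using s[OF that] by (simp add: s_def flip: sum_divide_distrib)
    show "x \<in> A y" if "x \<in> topspace X" "\<sigma> y x / s x \<noteq> 0" for y x
      using that nn[of y x] by (auto simp: A_def less_le)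
    show "A y \<subseteq> topspace X \<and> A y \<noteq> {}" if "y \<in> Y" for y
      using self Y(2) that by (auto simp: A_def)
    show "\<bar>f x - f x'\<bar> \<le> \<tau>" if "f \<in> F" "x \<in> A y" "x' \<in> A y" for y f x x'
      using small[OF that(1,2)] small[OF that(1,3)] by linarith
  qed (use Y in auto)
qed

text \<open>The operator \<open>T\<close> replaces a function by its local suprema. Since f \<le> T
  f \<le> f + \<tau> on \<open>F\<close>, the functional \<nu> composed with \<open>T\<close> is
  \<tau>-close to \<nu> there. Truncation, this change of functional and rounding to the grid cost
  \<theta> each, and \<open>e = 3 * \<theta>\<close>.\<close>

lemma finite_dominating_family:
  assumes X: "compact_space X" and \<Phi>: "cts (OH X) \<Phi>" and "e > 0"
  obtains Q where "finite Q" "Q \<subseteq> Cfun X"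
    "\<And>q \<nu>. q \<in> Q \<Longrightarrow> \<nu> \<in> topspace (OH X) \<Longrightarrow> \<nu> q \<le> \<Phi> \<nu> + e"
    "\<And>\<phi>. \<phi> \<in> Cfun X \<Longrightarrow> (\<And>\<nu>. \<nu> \<in> topspace (OH X) \<Longrightarrow> \<nu> \<phi> \<le> \<Phi> \<nu>) \<Longrightarrow>
       \<exists>q\<in>Q. \<forall>x\<in>topspace X. \<phi> x \<le> q x"
proof -
  define \<theta> where "\<theta> = e / 3"
  have \<theta>: "\<theta> > 0" using \<open>e > 0\<close> by (simp add: \<theta>_def)
  obtain M where M: "M > 0"
    "\<And>\<phi> x. cts X \<phi> \<Longrightarrow> (\<And>\<nu>. \<nu> \<in> topspace (OH X) \<Longrightarrow> ev X \<nu> \<phi> \<le> \<Phi> \<nu>) \<Longrightarrow> x \<in> topspace X \<Longrightarrow> \<phi> x \<le> M"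
    "\<And>\<phi> \<nu>. cts X \<phi> \<Longrightarrow> (\<And>\<nu>. \<nu> \<in> topspace (OH X) \<Longrightarrow> ev X \<nu> \<phi> \<le> \<Phi> \<nu>) \<Longrightarrow> \<nu> \<in> topspace (OH X) \<Longrightarrow>
       ev X \<nu> (\<lambda>x. max (\<phi> x) (- M)) \<le> \<Phi> \<nu> + \<theta>"
    using OH_truncation[OF X \<Phi> \<theta>] by blast
  obtain F \<tau> where F: "finite F" "F \<subseteq> Cfun X" "\<tau> > 0"
    "\<And>\<nu> \<nu>'. \<nu> \<in> topspace (OH X) \<Longrightarrow> \<nu>' \<in> topspace (OH X) \<Longrightarrow>
      (\<And>f. f \<in> F \<Longrightarrow> \<bar>\<nu>' f - \<nu> f\<bar> \<le> \<tau>) \<Longrightarrow> \<bar>\<Phi> \<nu>' - \<Phi> \<nu>\<bar> < \<theta>"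
    using OH_uniform_continuity[OF \<Phi> \<theta>] by blast
  obtain Y and \<rho> :: "'a \<Rightarrow> 'a \<Rightarrow> real" and A where Y:
    "finite Y" "\<And>y. y \<in> Y \<Longrightarrow> cts X (\<rho> y)"
    "\<And>y x. y \<in> Y \<Longrightarrow> x \<in> topspace X \<Longrightarrow> 0 \<le> \<rho> y x"
    "\<And>x. x \<in> topspace X \<Longrightarrow> (\<Sum>y\<in>Y. \<rho> y x) = 1"
    "\<And>y x. y \<in> Y \<Longrightarrow> x \<in> topspace X \<Longrightarrow> \<rho> y x \<noteq> 0 \<Longrightarrow> x \<in> A y"
    "\<And>y. y \<in> Y \<Longrightarrow> A y \<subseteq> topspace X \<and> A y \<noteq> {}"
    "\<And>y f x x'. y \<in> Y \<Longrightarrow> f \<in> F \<Longrightarrow> x \<in> A y \<Longrightarrow> x' \<in> A y \<Longrightarrow> \<bar>f x - f x'\<bar> \<le> \<tau>"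
    by (rule small_oscillation_partition_of_unity[OF X F(1-3)]) (rule that)
  define comb where "comb = (\<lambda>n x. \<Sum>y\<in>Y. \<rho> y x * n y)"
  have ct: "cts X (comb n)" for n
    unfolding comb_def using Y(1,2) by (intro continuous_intros) auto
  \<comment> \<open>Only indices with \<open>x \<in> A y\<close> count, since
    \<open>\<rho> y x\<close> vanishes for the others.\<close>
  have comb_mono: "comb n x \<le> comb n' x"
    if "x \<in> topspace X" "\<And>y. y \<in> Y \<Longrightarrow> x \<in> A y \<Longrightarrow> n y \<le> n' y" for n n' x
    unfolding comb_def
  proof (rule sum_mono)
    fix y assume "y \<in> Y"
    then show "\<rho> y x * n y \<le> \<rho> y x * n' y"
      using Y(3,5) that by (cases "\<rho> y x = 0") (auto intro: mult_left_mono)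
  qed
  have comb_add: "comb (\<lambda>y. n y + c) x = comb n x + c" if "x \<in> topspace X" for n c x
    using Y(4)[OF that] by (simp add: comb_def distrib_left sum.distrib flip: sum_distrib_right)
  have comb_const: "comb (\<lambda>y. c) x = c" if "x \<in> topspace X" for c x
    using Y(4)[OF that] by (simp add: comb_def flip: sum_distrib_right)
  have SUP: "weak_functional X (\<lambda>f. Sup (f ` A y))" if "y \<in> Y" for y
    using weak_functional_SUP[OF X] Y(6)[OF that] by blast
  define T where "T = (\<lambda>f. comb (\<lambda>y. Sup (f ` A y)))"
  \<comment> \<open>\<open>T\<close> is not linear, but it is monotone and commutes on
    \<open>topspace X\<close> with adding constants and with nonnegative scaling, as the \<rho> sum
    to 1; precomposition with such an operator preserves the axioms.\<close>
  have T_weak: "weak_functional X (\<lambda>f. V (T f))" if V: "weak_functional X V" for V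
  proof (rule weak_functionalI)
    fix f :: "'a \<Rightarrow> real" and c assume f: "cts X f"
    have "V (T (\<lambda>x. f x + c)) = V (\<lambda>x. T f x + c)"
    proof (rule weak_functional_cong[OF V])
      fix x assume x: "x \<in> topspace X"
      have "T (\<lambda>x. f x + c) x = comb (\<lambda>y. Sup (f ` A y) + c) x"
        unfolding T_def comb_def using weak_functional_add[OF SUP f] by (intro sum.cong) auto
      then show "T (\<lambda>x. f x + c) x = T f x + c" using comb_add[OF x] by (simp add: T_def)
    qed (use ct in \<open>auto simp: T_def intro: continuous_map_add\<close>)
    then show "V (T (\<lambda>x. f x + c)) = V (T f) + c"
      using weak_functional_add[OF V] ct by (simp add: T_def)
  next
    fix f g :: "'a \<Rightarrow> real"
    assume f: "cts X f" "cts X g" "\<And>x. x \<in> topspace X \<Longrightarrow> f x \<le> g x"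
    have "T f x \<le> T g x" if "x \<in> topspace X" for x
      unfolding T_def by (intro comb_mono weak_functional_mono[OF SUP] f that) auto
    then show "V (T f) \<le> V (T g)"
      using weak_functional_mono[OF V] ct by (simp add: T_def)
  next
    fix f :: "'a \<Rightarrow> real" and t::real assume f: "cts X f" "t \<ge> 0"
    have "T (\<lambda>x. t * f x) = (\<lambda>x. t * T f x)"
      unfolding T_def comb_def sum_distrib_left using weak_functional_scale[OF SUP f]
      by (intro ext sum.cong) auto
    then show "V (T (\<lambda>x. t * f x)) = t * V (T f)"
      using weak_functional_scale[OF V _ f(2)] ct by (simp add: T_def)
  qed
  have T_ge: "f x \<le> T f x" if f: "cts X f" and x: "x \<in> topspace X" for f x
  proof -
    have "f x \<le> Sup (f ` A y)" if "y \<in> Y" "x \<in> A y" for y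
      using cts_bdd_above[OF X f] Y(6)[OF that(1)] that(2) by (intro cSUP_upper) auto
    then have "comb (\<lambda>y. f x) x \<le> T f x" unfolding T_def by (intro comb_mono[OF x])
    then show ?thesis using comb_const[OF x] by simp
  qed
  have T_F: "T f x \<le> f x + \<tau>" if f: "f \<in> F" and x: "x \<in> topspace X" for f x
  proof -
    have "Sup (f ` A y) \<le> f x + \<tau>" if y: "y \<in> Y" "x \<in> A y" for y
    proof (rule cSUP_least)
      fix z assume "z \<in> A y"
      then show "f z \<le> f x + \<tau>" using Y(7)[OF y(1) f _ y(2), of z] by (simp add: abs_le_iff)
    qed (use y in auto)
    then have "T f x \<le> comb (\<lambda>y. f x + \<tau>) x" unfolding T_def by (intro comb_mono[OF x])
    then show ?thesis using comb_const[OF x] by simp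
  qed
  \<comment> \<open>All coefficients lie between \<open>- M\<close> and \<open>M\<close>, so their
    multiples of \<theta> rounded up have indices between \<open>- K\<close> and
    \<open>K\<close>.\<close>
  define K where "K = \<lceil>M / \<theta>\<rceil>"
  define G where "G = (\<lambda>k. \<theta> * real_of_int k) ` {- K..K}"
  define Q0 where "Q0 = (\<lambda>n. restrict (comb n) (topspace X)) ` PiE Y (\<lambda>_. G)"
  \<comment> \<open>The required upper bound is imposed as a filter on the grid; the work is to show
    that the function built from a given \<phi> passes it.\<close>
  define Q where "Q = {q \<in> Q0. \<forall>\<nu>\<in>topspace (OH X). \<nu> q \<le> \<Phi> \<nu> + e}"
  have "finite Q0" unfolding Q0_def G_def using Y(1) by (intro finite_imageI finite_PiE) auto
  show ?thesis
  proof (rule that[of Q])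
    show "finite Q" using \<open>finite Q0\<close> by (simp add: Q_def)
    show "Q \<subseteq> Cfun X" unfolding Q_def Q0_def using restrict_in_Cfun[OF ct] by blast
    show "\<nu> q \<le> \<Phi> \<nu> + e" if "q \<in> Q" "\<nu> \<in> topspace (OH X)" for q \<nu>
      using that by (simp add: Q_def)
    fix \<phi> assume \<phi>C: "\<phi> \<in> Cfun X" and le: "\<And>\<nu>. \<nu> \<in> topspace (OH X) \<Longrightarrow> \<nu> \<phi> \<le> \<Phi> \<nu>"
    have \<phi>: "cts X \<phi>" by (rule CfunD(1)[OF \<phi>C])
    have le': "\<And>\<nu>. \<nu> \<in> topspace (OH X) \<Longrightarrow> ev X \<nu> \<phi> \<le> \<Phi> \<nu>"
      using le by (simp add: ev_Cfun[OF \<phi>C])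
    define \<phi>' where "\<phi>' = (\<lambda>x. max (\<phi> x) (- M))"
    have \<phi>': "cts X \<phi>'" unfolding \<phi>'_def using \<phi> by (intro continuous_intros) auto
    have \<phi>'_bd: "- M \<le> \<phi>' x" "\<phi>' x \<le> M" if "x \<in> topspace X" for x
      using M(2)[OF \<phi> le' that] M(1) by (auto simp: \<phi>'_def)
    define m where "m = (\<lambda>y. Sup (\<phi>' ` A y))"
    have m: "- M \<le> m y" "m y \<le> M" if "y \<in> Y" for y
      unfolding m_def
      using weak_functional_le_const[OF SUP[OF that] \<phi>'] weak_functional_ge_const[OF SUP[OF that] \<phi>'] \<phi>'_bd
      by blast+
    \<comment> \<open>Restricting to \<open>Y\<close> makes \<open>n\<close> extensional, as
      membership in \<open>PiE\<close> demands.\<close>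
    define n where "n = restrict (\<lambda>y. \<theta> * real_of_int \<lceil>m y / \<theta>\<rceil>) Y"
    have n: "m y \<le> n y" "n y \<le> m y + \<theta>" "n y \<in> G" if y: "y \<in> Y" for y
    proof -
      have "\<theta> * (m y / \<theta>) \<le> \<theta> * real_of_int \<lceil>m y / \<theta>\<rceil>"
        using \<theta> by (intro mult_left_mono) auto
      then show "m y \<le> n y" using \<theta> y by (simp add: n_def)
      have "real_of_int \<lceil>m y / \<theta>\<rceil> \<le> m y / \<theta> + 1"
        by linarith
      then show "n y \<le> m y + \<theta>" using \<theta> y by (simp add: n_def field_simps)
      have "\<lceil>m y / \<theta>\<rceil> \<le> K"
        unfolding K_def using m[OF y] \<theta> by (intro ceiling_mono divide_right_mono) auto
      moreover have "- (M / \<theta>) \<le> m y / \<theta>" using m[OF y] \<theta> by (simp add: field_simps)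
      then have "- K \<le> \<lceil>m y / \<theta>\<rceil>" unfolding K_def by linarith
      ultimately show "n y \<in> G" using y by (auto simp: n_def G_def)
    qed
    define q where "q = restrict (comb n) (topspace X)"
    have "n \<in> PiE Y (\<lambda>_. G)" using n(3) by (auto simp: n_def)
    then have "q \<in> Q0" unfolding q_def Q0_def by blast
    moreover have "\<nu> q \<le> \<Phi> \<nu> + e" if \<nu>: "\<nu> \<in> topspace (OH X)" for \<nu>
    proof -
      note V = OH_weak_functional[OF \<nu>]
      let ?V = "\<lambda>f. ev X \<nu> (T f)"
      let ?\<nu> = "restrict ?V (Cfun X)"
      have \<nu>': "?\<nu> \<in> topspace (OH X)" by (rule weak_functional_in_OH[OF X T_weak[OF V]])
      have "\<bar>?\<nu> f - \<nu> f\<bar> \<le> \<tau>" if f: "f \<in> F" for f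
      proof -
        have fC: "f \<in> Cfun X" using f F by blast
        note fc = CfunD(1)[OF fC]
        have "ev X \<nu> f \<le> ev X \<nu> (T f)"
          using T_ge[OF fc] ct by (intro weak_functional_mono[OF V fc]) (auto simp: T_def)
        moreover have "ev X \<nu> (T f) \<le> ev X \<nu> (\<lambda>x. f x + \<tau>)"
          using T_F[OF f] ct fc by (intro weak_functional_mono[OF V]) (auto simp: T_def intro: continuous_map_add)
        ultimately show ?thesis
          using weak_functional_add[OF V fc] fC by (simp add: ev_Cfun abs_le_iff)
      qed
      then have 1: "\<Phi> ?\<nu> < \<Phi> \<nu> + \<theta>" using F(4)[OF \<nu> \<nu>'] by (simp add: abs_less_iff)
      \<comment> \<open>Rounding costs \<theta>. The value of \<nu> at T \<phi>' is the value of the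
        modified functional at \<phi>', to which the truncation bound applies.\<close>
      have "ev X \<nu> (comb n) \<le> ev X \<nu> (\<lambda>x. T \<phi>' x + \<theta>)"
      proof (rule weak_functional_mono[OF V ct])
        fix x assume x: "x \<in> topspace X"
        have "comb n x \<le> comb (\<lambda>y. m y + \<theta>) x" using n(2) by (intro comb_mono[OF x])
        then show "comb n x \<le> T \<phi>' x + \<theta>" using comb_add[OF x] by (simp add: T_def m_def)
      qed (use ct in \<open>auto simp: T_def intro: continuous_map_add\<close>)
      also have "\<dots> = ?V \<phi>' + \<theta>" using weak_functional_add[OF V] ct by (simp add: T_def)
      also have "?V \<phi>' = ev X ?\<nu> \<phi>'" using weak_functional_ev[OF T_weak[OF V] \<phi>'] by simp
      also have "\<dots> \<le> \<Phi> ?\<nu> + \<theta>" unfolding \<phi>'_def by (rule M(3)[OF \<phi> le' \<nu>'])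
      finally have "ev X \<nu> (comb n) \<le> \<Phi> ?\<nu> + \<theta> + \<theta>" by simp
      then show ?thesis using 1 by (simp add: q_def ev_def \<theta>_def)
    qed
    ultimately have "q \<in> Q" by (simp add: Q_def)
    moreover have "\<phi> x \<le> q x" if x: "x \<in> topspace X" for x
    proof -
      have "\<phi> x \<le> \<phi>' x" by (simp add: \<phi>'_def)
      also have "\<dots> \<le> T \<phi>' x" by (rule T_ge[OF \<phi>' x])
      also have "\<dots> \<le> comb n x" unfolding T_def using n(1) by (intro comb_mono[OF x]) (simp add: m_def)
      finally show ?thesis using x by (simp add: q_def)
    qed
    ultimately show "\<exists>q\<in>Q. \<forall>x\<in>topspace X. \<phi> x \<le> q x" by blast
  qed
qed

section \<open>Openness of the multiplication\<close>

lemma continuous_map_into_OH: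
  assumes "\<And>z. z \<in> topspace Z \<Longrightarrow> h z \<in> topspace (OH X)"
    and "\<And>f. f \<in> Cfun X \<Longrightarrow> cts Z (\<lambda>z. h z f)"
  shows "continuous_map Z (OH X) h"
proof -
  have "h z \<in> Pi\<^sub>E (Cfun X) (\<lambda>f. {Inf (f ` topspace X)..Sup (f ` topspace X)}) \<and> is_OH X (h z)"
    if "z \<in> topspace Z" for z
    using assms(1)[OF that] unfolding OH_def by auto
  then have "continuous_map Z (product_topology
        (\<lambda>\<phi>. subtopology euclideanreal {Inf (\<phi> ` topspace X) .. Sup (\<phi> ` topspace X)}) (Cfun X)) h"
      and "h \<in> topspace Z \<rightarrow> {\<nu>. is_OH X \<nu>}"
    unfolding continuous_map_componentwise using assms(2)
    by (auto simp: continuous_map_in_subtopology PiE_def Pi_def)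
  then show ?thesis
    unfolding OH_def by (simp add: continuous_map_in_subtopology image_subset_iff_funcset)
qed

section \<open>Duality and families bounding from below\<close>

definition dual_functional :: "'a topology \<Rightarrow> (('a \<Rightarrow> real) \<Rightarrow> real) \<Rightarrow> (('a \<Rightarrow> real) \<Rightarrow> real)" where
  "dual_functional X \<nu> = restrict (\<lambda>f. - ev X \<nu> (\<lambda>x. - f x)) (Cfun X)"

lemma dual_functional_in_OH:
  "compact_space X \<Longrightarrow> \<nu> \<in> topspace (OH X) \<Longrightarrow> dual_functional X \<nu> \<in> topspace (OH X)"
  unfolding dual_functional_def
  by (intro weak_functional_in_OH weak_functional_dual OH_weak_functional)

lemma ev_dual_functional:
  "\<nu> \<in> topspace (OH X) \<Longrightarrow> cts X f \<Longrightarrow> ev X (dual_functional X \<nu>) f = - ev X \<nu> (\<lambda>x. - f x)"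
  unfolding dual_functional_def
  by (rule weak_functional_ev[OF weak_functional_dual[OF OH_weak_functional]])

lemma dual_dual_functional:
  assumes "compact_space X" "\<nu> \<in> topspace (OH X)"
  shows "dual_functional X (dual_functional X \<nu>) = \<nu>"
proof
  fix f
  show "dual_functional X (dual_functional X \<nu>) f = \<nu> f"
  proof (cases "f \<in> Cfun X")
    case True
    then have "dual_functional X (dual_functional X \<nu>) f = - ev X (dual_functional X \<nu>) (\<lambda>x. - f x)"
      by (simp add: dual_functional_def)
    also have "\<dots> = ev X \<nu> f"
      using ev_dual_functional[OF assms(2), of "\<lambda>x. - f x"] CfunD(1)[OF True]
      by (simp add: continuous_map_minus)
    finally show ?thesis using True by (simp add: ev_Cfun)
  next
    case False
    \<comment> \<open>Outside \<open>Cfun X\<close> both sides are \<open>undefined\<close>.\<close>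
    then show ?thesis using assms
      by (auto simp: dual_functional_def topspace_OH extensional_def)
  qed
qed

lemma cts_dual_functional:
  assumes "compact_space X" "cts (OH X) \<Phi>"
  shows "cts (OH X) (\<lambda>\<nu>. \<Phi> (dual_functional X \<nu>))"
proof -
  have "continuous_map (OH X) (OH X) (dual_functional X)"
  proof (rule continuous_map_into_OH)
    fix f assume f: "f \<in> Cfun X"
    have "cts (OH X) (\<lambda>\<nu>. - ev X \<nu> (\<lambda>x. - f x))"
      using CfunD(1)[OF f] by (intro continuous_map_minus cts_OH_ev)
    then show "cts (OH X) (\<lambda>\<nu>. dual_functional X \<nu> f)"
      using f by (simp add: dual_functional_def)
  qed (rule dual_functional_in_OH[OF assms(1)])
  from continuous_map_compose[OF this assms(2)] show ?thesis by (simp add: o_def)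
qed

text \<open>Apply \<open>finite_dominating_family\<close> to the negative of \<Phi> composed with
  the duality: \<open>\<Phi> \<le> \<pi>\<^sub>\<phi>\<close> becomes an upper bound on the
  evaluation at the negative of \<phi>. Negating the family obtained gives the claim.\<close>

lemma finite_dominated_family:
  assumes X: "compact_space X" and \<Phi>: "cts (OH X) \<Phi>" and "e > 0"
  obtains Q where "finite Q" "Q \<subseteq> Cfun X"
    "\<And>q \<nu>. q \<in> Q \<Longrightarrow> \<nu> \<in> topspace (OH X) \<Longrightarrow> \<Phi> \<nu> - e \<le> \<nu> q"
    "\<And>\<phi>. \<phi> \<in> Cfun X \<Longrightarrow> (\<And>\<nu>. \<nu> \<in> topspace (OH X) \<Longrightarrow> \<Phi> \<nu> \<le> \<nu> \<phi>) \<Longrightarrow>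
       \<exists>q\<in>Q. \<forall>x\<in>topspace X. q x \<le> \<phi> x"
proof -
  let ?D = "dual_functional X" and ?neg = "\<lambda>f. restrict (\<lambda>x. - f x) (topspace X)"
  have negC: "?neg f \<in> Cfun X" if "f \<in> Cfun X" for f
    using CfunD(1)[OF that] by (intro restrict_in_Cfun continuous_map_minus)
  have "cts (OH X) (\<lambda>\<nu>. - \<Phi> (?D \<nu>))"
    by (intro continuous_map_minus cts_dual_functional X \<Phi>)
  then obtain Q where Q: "finite Q" "Q \<subseteq> Cfun X"
    "\<And>q \<nu>. q \<in> Q \<Longrightarrow> \<nu> \<in> topspace (OH X) \<Longrightarrow> \<nu> q \<le> - \<Phi> (?D \<nu>) + e"
    "\<And>\<phi>. \<phi> \<in> Cfun X \<Longrightarrow> (\<And>\<nu>. \<nu> \<in> topspace (OH X) \<Longrightarrow> \<nu> \<phi> \<le> - \<Phi> (?D \<nu>)) \<Longrightarrow>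
       \<exists>q\<in>Q. \<forall>x\<in>topspace X. \<phi> x \<le> q x"
    using finite_dominating_family[OF X _ \<open>e > 0\<close>] by blast
  have D: "?D \<nu> f = - \<nu> (?neg f)" if "f \<in> Cfun X" for \<nu> f
    using that by (simp add: dual_functional_def ev_def)
  show ?thesis
  proof (rule that[of "?neg ` Q"])
    fix q \<nu> assume "q \<in> ?neg ` Q" and \<nu>: "\<nu> \<in> topspace (OH X)"
    then obtain q' where q': "q' \<in> Q" "q = ?neg q'" by blast
    have "?D \<nu> q' \<le> - \<Phi> \<nu> + e"
      using Q(3)[OF q'(1) dual_functional_in_OH[OF X \<nu>]] dual_dual_functional[OF X \<nu>] by simp
    moreover have "?D \<nu> q' = - \<nu> q" using D q' Q(2) by blast
    ultimately show "\<Phi> \<nu> - e \<le> \<nu> q" by linarith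
  next
    fix \<phi> assume \<phi>: "\<phi> \<in> Cfun X" "\<And>\<nu>. \<nu> \<in> topspace (OH X) \<Longrightarrow> \<Phi> \<nu> \<le> \<nu> \<phi>"
    have "\<nu> (?neg \<phi>) \<le> - \<Phi> (?D \<nu>)" if "\<nu> \<in> topspace (OH X)" for \<nu>
      using \<phi>(2)[OF dual_functional_in_OH[OF X that]] D[OF \<phi>(1), of \<nu>] by simp
    then obtain q where q: "q \<in> Q" "\<forall>x\<in>topspace X. ?neg \<phi> x \<le> q x"
      using Q(4)[OF negC[OF \<phi>(1)]] by blast
    then have "\<forall>x\<in>topspace X. ?neg q x \<le> \<phi> x" by fastforce
    then show "\<exists>q\<in>?neg ` Q. \<forall>x\<in>topspace X. q x \<le> \<phi> x" using q(1) by blast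
  qed (use Q(1,2) negC in auto)
qed

section \<open>Clamping to prescribed values at evaluations\<close>

definition evaluation_data ::
  "'a topology \<Rightarrow> real \<Rightarrow> (('a \<Rightarrow> real) \<Rightarrow> real) \<Rightarrow> ((('a \<Rightarrow> real) \<Rightarrow> real) \<Rightarrow> real) \<Rightarrow> real \<Rightarrow> bool" where
  "evaluation_data X s \<kappa> g v \<longleftrightarrow>
     (\<exists>\<phi>\<in>Cfun X. (\<forall>l\<in>topspace (OH X). g l = s * l \<phi>) \<and> v = s * \<kappa> \<phi>)"

text \<open>The sign s = 1 serves the smallest functional, and s = -1 serves the largest as the dual
  of a smallest one. Because \<open>s * s = 1\<close>, adding \<open>c\<close> to
  \<open>s * l \<phi>\<close> amounts to adding \<open>s * c\<close> to \<phi>. The property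
  \<open>bound\<close> is read off at the point \<kappa>, where
  \<open>g \<kappa> = v\<close>.\<close>

lemma extension_data_evaluation:
  assumes \<kappa>: "\<kappa> \<in> topspace (OH X)" and s: "s * s = (1::real)"
  shows "extension_data (OH X) (evaluation_data X s \<kappa>)"
proof
  show "\<exists>g v. evaluation_data X s \<kappa> g v"
    unfolding evaluation_data_def using restrict_in_Cfun[of X "\<lambda>x. 0"] by fastforce
next
  fix g v c assume "evaluation_data X s \<kappa> g v"
  then obtain \<phi> where \<phi>: "\<phi> \<in> Cfun X" "\<And>l. l \<in> topspace (OH X) \<Longrightarrow> g l = s * l \<phi>" "v = s * \<kappa> \<phi>"
    unfolding evaluation_data_def by blast
  let ?f = "restrict (\<lambda>x. \<phi> x + s * c) (topspace X)"
  have "?f \<in> Cfun X" using CfunD(1)[OF \<phi>(1)] by (intro restrict_in_Cfun continuous_map_add) auto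
  moreover have "s * l \<phi> + c = s * l ?f" if "l \<in> topspace (OH X)" for l
    using weak_functional_add[OF OH_weak_functional[OF that] CfunD(1)[OF \<phi>(1)], of "s * c"] s
    by (simp add: ev_Cfun[OF \<phi>(1)]) (simp add: ev_def distrib_left flip: mult.assoc)
  ultimately show "evaluation_data X s \<kappa> (\<lambda>l. g l + c) (v + c)"
    unfolding evaluation_data_def using \<phi> \<kappa> by (intro bexI[of _ ?f]) auto
next
  fix g v and t :: real assume "evaluation_data X s \<kappa> g v" "t \<ge> 0"
  then obtain \<phi> where \<phi>: "\<phi> \<in> Cfun X" "\<And>l. l \<in> topspace (OH X) \<Longrightarrow> g l = s * l \<phi>" "v = s * \<kappa> \<phi>"
    unfolding evaluation_data_def by blast
  let ?f = "restrict (\<lambda>x. t * \<phi> x) (topspace X)"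
  have "?f \<in> Cfun X" using CfunD(1)[OF \<phi>(1)] by (intro restrict_in_Cfun continuous_map_real_mult_left)
  moreover have "t * (s * l \<phi>) = s * l ?f" if "l \<in> topspace (OH X)" for l
    using weak_functional_scale[OF OH_weak_functional[OF that] CfunD(1)[OF \<phi>(1)] \<open>t \<ge> 0\<close>]
    by (simp add: ev_Cfun[OF \<phi>(1)]) (simp add: ev_def)
  ultimately show "evaluation_data X s \<kappa> (\<lambda>l. t * g l) (t * v)"
    unfolding evaluation_data_def using \<phi> \<kappa> by (intro bexI[of _ ?f]) auto
next
  fix g v b assume "evaluation_data X s \<kappa> g v" "\<And>l. l \<in> topspace (OH X) \<Longrightarrow> g l \<le> b"
  then show "v \<le> b"
    unfolding evaluation_data_def using \<kappa> by metis
qed (rule compact_space_OH)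

definition clamp_OH ::
  "'a topology \<Rightarrow> (('a \<Rightarrow> real) \<Rightarrow> real) \<Rightarrow> (((('a \<Rightarrow> real) \<Rightarrow> real) \<Rightarrow> real) \<Rightarrow> real) \<Rightarrow>
    ((('a \<Rightarrow> real) \<Rightarrow> real) \<Rightarrow> real) \<Rightarrow> real" where
  "clamp_OH X \<kappa> V = (\<lambda>\<Phi>. max (lower_extension (OH X) (evaluation_data X 1 \<kappa>) \<Phi>)
     (min (- lower_extension (OH X) (evaluation_data X (- 1) \<kappa>) (\<lambda>l. - \<Phi> l)) (V \<Phi>)))"

text \<open>Both \<open>L\<close> and \<open>U\<close> take the value \<open>\<kappa> \<phi>\<close>
  at the evaluation at \<phi>, which forces the clamped value there whatever \<open>V\<close> is.
  Upper estimates use only \<open>L\<close> and \<open>V\<close>, lower ones only \<open>U\<close>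
  and \<open>V\<close>.\<close>

lemma clamp_OH:
  assumes V: "weak_functional (OH X) V" and \<kappa>: "\<kappa> \<in> topspace (OH X)"
  shows weak_functional_clamp_OH: "weak_functional (OH X) (clamp_OH X \<kappa> V)"
    and clamp_OH_eval: "\<And>\<phi>. \<phi> \<in> Cfun X \<Longrightarrow> clamp_OH X \<kappa> V (\<lambda>l. l \<phi>) = \<kappa> \<phi>"
    and clamp_OH_le: "\<And>\<Phi> b. cts (OH X) \<Phi> \<Longrightarrow>
       (\<And>\<phi>. \<phi> \<in> Cfun X \<Longrightarrow> (\<And>l. l \<in> topspace (OH X) \<Longrightarrow> l \<phi> \<le> \<Phi> l) \<Longrightarrow> \<kappa> \<phi> \<le> b) \<Longrightarrow>
       V \<Phi> \<le> b \<Longrightarrow> clamp_OH X \<kappa> V \<Phi> \<le> b"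
    and clamp_OH_ge: "\<And>\<Phi> b. cts (OH X) \<Phi> \<Longrightarrow>
       (\<And>\<phi>. \<phi> \<in> Cfun X \<Longrightarrow> (\<And>l. l \<in> topspace (OH X) \<Longrightarrow> \<Phi> l \<le> l \<phi>) \<Longrightarrow> b \<le> \<kappa> \<phi>) \<Longrightarrow>
       b \<le> V \<Phi> \<Longrightarrow> b \<le> clamp_OH X \<kappa> V \<Phi>"
proof -
  interpret L: extension_data "OH X" "evaluation_data X 1 \<kappa>"
    by (rule extension_data_evaluation[OF \<kappa>]) simp
  interpret U: extension_data "OH X" "evaluation_data X (-1) \<kappa>"
    by (rule extension_data_evaluation[OF \<kappa>]) simp
  define L where "L = lower_extension (OH X) (evaluation_data X 1 \<kappa>)"
  define U where "U = (\<lambda>\<Phi>. - lower_extension (OH X) (evaluation_data X (-1) \<kappa>) (\<lambda>l. - \<Phi> l))"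
  have wL: "weak_functional (OH X) L"
    unfolding L_def by (rule L.weak_functional_lower_extension)
  have wU: "weak_functional (OH X) U"
    unfolding U_def by (rule weak_functional_dual[OF U.weak_functional_lower_extension])
  have L_le: "L \<Phi> \<le> b"
    if "cts (OH X) \<Phi>"
      "\<And>\<phi>. \<phi> \<in> Cfun X \<Longrightarrow> (\<And>l. l \<in> topspace (OH X) \<Longrightarrow> l \<phi> \<le> \<Phi> l) \<Longrightarrow> \<kappa> \<phi> \<le> b" for \<Phi> b
    unfolding L_def
  proof (rule L.least[OF that(1)])
    fix g v assume "evaluation_data X 1 \<kappa> g v" and g: "\<And>l. l \<in> topspace (OH X) \<Longrightarrow> g l \<le> \<Phi> l"
    then obtain \<phi> where "\<phi> \<in> Cfun X" "\<And>l. l \<in> topspace (OH X) \<Longrightarrow> g l = l \<phi>" "v = \<kappa> \<phi>"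
      unfolding evaluation_data_def by auto
    then show "v \<le> b" using that(2) g by fastforce
  qed
  have U_ge: "b \<le> U \<Phi>"
    if "cts (OH X) \<Phi>"
      "\<And>\<phi>. \<phi> \<in> Cfun X \<Longrightarrow> (\<And>l. l \<in> topspace (OH X) \<Longrightarrow> \<Phi> l \<le> l \<phi>) \<Longrightarrow> b \<le> \<kappa> \<phi>" for \<Phi> b
  proof -
    have "lower_extension (OH X) (evaluation_data X (-1) \<kappa>) (\<lambda>l. - \<Phi> l) \<le> - b"
    proof (rule U.least)
      fix g v assume "evaluation_data X (-1) \<kappa> g v" and g: "\<And>l. l \<in> topspace (OH X) \<Longrightarrow> g l \<le> - \<Phi> l"
      then obtain \<phi> where \<phi>: "\<phi> \<in> Cfun X" "\<And>l. l \<in> topspace (OH X) \<Longrightarrow> g l = - l \<phi>" "v = - \<kappa> \<phi>"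
        unfolding evaluation_data_def by auto
      have "b \<le> \<kappa> \<phi>"
        by (rule that(2)[OF \<phi>(1)]) (use g \<phi>(2) in fastforce)
      then show "v \<le> - b" using \<phi>(3) by simp
    qed (rule continuous_map_minus[OF that(1)])
    then show ?thesis by (simp add: U_def)
  qed
  have L_eval: "L (\<lambda>l. l \<phi>) = \<kappa> \<phi>" if \<phi>: "\<phi> \<in> Cfun X" for \<phi>
  proof (rule antisym)
    \<comment> \<open>An inequality between two evaluations, taken at the point l = \<kappa>, is the
      required inequality of values.\<close>
    show "L (\<lambda>l. l \<phi>) \<le> \<kappa> \<phi>" by (rule L_le[OF cts_OH_eval[OF \<phi>]]) (use \<kappa> in blast)
    show "\<kappa> \<phi> \<le> L (\<lambda>l. l \<phi>)"
      unfolding L_def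
      by (rule L.upper[OF cts_OH_eval[OF \<phi>], of "\<lambda>l. l \<phi>"]) (use \<phi> in \<open>auto simp: evaluation_data_def\<close>)
  qed
  have U_eval: "U (\<lambda>l. l \<phi>) = \<kappa> \<phi>" if \<phi>: "\<phi> \<in> Cfun X" for \<phi>
  proof (rule antisym)
    show "\<kappa> \<phi> \<le> U (\<lambda>l. l \<phi>)" by (rule U_ge[OF cts_OH_eval[OF \<phi>]]) (use \<kappa> in blast)
    have "- \<kappa> \<phi> \<le> lower_extension (OH X) (evaluation_data X (-1) \<kappa>) (\<lambda>l. - l \<phi>)"
      by (rule U.upper[OF continuous_map_minus[OF cts_OH_eval[OF \<phi>]], of "\<lambda>l. - l \<phi>"])
        (use \<phi> in \<open>auto simp: evaluation_data_def\<close>)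
    then show "U (\<lambda>l. l \<phi>) \<le> \<kappa> \<phi>" by (simp add: U_def)
  qed
  have clamp_eq: "clamp_OH X \<kappa> V = (\<lambda>\<Phi>. max (L \<Phi>) (min (U \<Phi>) (V \<Phi>)))"
    by (simp add: clamp_OH_def L_def U_def)
  show "weak_functional (OH X) (clamp_OH X \<kappa> V)"
    unfolding clamp_eq by (intro weak_functional_max weak_functional_min wL wU V)
  show "clamp_OH X \<kappa> V (\<lambda>l. l \<phi>) = \<kappa> \<phi>" if "\<phi> \<in> Cfun X" for \<phi>
    using L_eval[OF that] U_eval[OF that] by (simp add: clamp_eq)
  show "clamp_OH X \<kappa> V \<Phi> \<le> b" if "cts (OH X) \<Phi>" "V \<Phi> \<le> b"
    "\<And>\<phi>. \<phi> \<in> Cfun X \<Longrightarrow> (\<And>l. l \<in> topspace (OH X) \<Longrightarrow> l \<phi> \<le> \<Phi> l) \<Longrightarrow> \<kappa> \<phi> \<le> b" for \<Phi> b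
    using L_le[OF that(1,3)] that(2) by (simp add: clamp_eq min_le_iff_disj)
  show "b \<le> clamp_OH X \<kappa> V \<Phi>" if "cts (OH X) \<Phi>" "b \<le> V \<Phi>"
    "\<And>\<phi>. \<phi> \<in> Cfun X \<Longrightarrow> (\<And>l. l \<in> topspace (OH X) \<Longrightarrow> \<Phi> l \<le> l \<phi>) \<Longrightarrow> b \<le> \<kappa> \<phi>" for \<Phi> b
    using U_ge[OF that(1,3)] that(2) by (simp add: clamp_eq le_max_iff_disj)
qed

section \<open>The multiplication map and its openness\<close>

lemma muOH_apply: "\<phi> \<in> Cfun X \<Longrightarrow> muOH X \<Lambda> \<phi> = ev (OH X) \<Lambda> (\<lambda>l. l \<phi>)"
  by (simp add: muOH_def ev_def)

text \<open>The map sending \<open>f\<close> to its evaluation respects order, added constants and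
  nonnegative scaling because every point of OH(X) does; composing it with a weak functional gives
  another.\<close>

lemma muOH_in_OH:
  assumes X: "compact_space X" and "\<Lambda> \<in> topspace (OH (OH X))"
  shows "muOH X \<Lambda> \<in> topspace (OH X)"
proof -
  note V = OH_weak_functional[OF assms(2)]
  let ?V = "\<lambda>f. ev (OH X) \<Lambda> (\<lambda>l. ev X l f)"
  have "weak_functional X ?V"
  proof (rule weak_functionalI)
    fix f :: "'a \<Rightarrow> real" and c assume f: "cts X f"
    have "?V (\<lambda>x. f x + c) = ev (OH X) \<Lambda> (\<lambda>l. ev X l f + c)"
      using f by (intro weak_functional_cong[OF V] cts_OH_ev continuous_map_add)
        (auto simp: weak_functional_add[OF OH_weak_functional])
    then show "?V (\<lambda>x. f x + c) = ?V f + c"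
      using weak_functional_add[OF V cts_OH_ev[OF f]] by simp
  next
    fix f :: "'a \<Rightarrow> real" and t::real assume f: "cts X f" "t \<ge> 0"
    have "?V (\<lambda>x. t * f x) = ev (OH X) \<Lambda> (\<lambda>l. t * ev X l f)"
      using f by (intro weak_functional_cong[OF V] cts_OH_ev continuous_map_real_mult_left)
        (auto simp: weak_functional_scale[OF OH_weak_functional])
    then show "?V (\<lambda>x. t * f x) = t * ?V f"
      using weak_functional_scale[OF V cts_OH_ev[OF f(1)] f(2)] by simp
  next
    fix f g :: "'a \<Rightarrow> real"
    assume f: "cts X f" "cts X g" "\<And>x. x \<in> topspace X \<Longrightarrow> f x \<le> g x"
    show "?V f \<le> ?V g"
      by (intro weak_functional_mono[OF V] cts_OH_ev weak_functional_mono[OF OH_weak_functional] f)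
  qed
  moreover have "muOH X \<Lambda> = restrict ?V (Cfun X)"
  proof
    show "muOH X \<Lambda> f = restrict ?V (Cfun X) f" for f
      by (cases "f \<in> Cfun X") (simp_all add: muOH_apply ev_Cfun, simp add: muOH_def)
  qed
  ultimately show ?thesis using weak_functional_in_OH[OF X] by simp
qed

text \<open>Infinitely many \<phi> are controlled through finitely many \<open>q\<close>:
  \<kappa>(\<phi>) \<le> \<kappa>(q), which is within d of \<Lambda> at the evaluation at
  \<open>q\<close>, and that is at most \<Lambda>(\<Phi>) + d. With \<open>e = 2 * d\<close> this is
  the upper bound; the family \<open>R\<close> gives the lower one.\<close>

lemma OH_neighbourhood_near_fibre:
  assumes X: "compact_space X" and \<Lambda>: "\<Lambda> \<in> topspace (OH (OH X))"
    and \<Phi>: "cts (OH X) \<Phi>" and "e > 0"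
  obtains N where "openin (OH X) N" "muOH X \<Lambda> \<in> N"
    "\<And>\<kappa> \<phi>. \<kappa> \<in> N \<Longrightarrow> \<phi> \<in> Cfun X \<Longrightarrow> (\<And>l. l \<in> topspace (OH X) \<Longrightarrow> l \<phi> \<le> \<Phi> l) \<Longrightarrow>
       \<kappa> \<phi> \<le> ev (OH X) \<Lambda> \<Phi> + e"
    "\<And>\<kappa> \<phi>. \<kappa> \<in> N \<Longrightarrow> \<phi> \<in> Cfun X \<Longrightarrow> (\<And>l. l \<in> topspace (OH X) \<Longrightarrow> \<Phi> l \<le> l \<phi>) \<Longrightarrow>
       ev (OH X) \<Lambda> \<Phi> - e \<le> \<kappa> \<phi>"
proof -
  note V = OH_weak_functional[OF \<Lambda>]
  let ?m = "muOH X \<Lambda>"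
  define d where "d = e / 2"
  have "d > 0" using \<open>e > 0\<close> by (simp add: d_def)
  obtain Q where Q: "finite Q" "Q \<subseteq> Cfun X"
    "\<And>q \<nu>. q \<in> Q \<Longrightarrow> \<nu> \<in> topspace (OH X) \<Longrightarrow> \<nu> q \<le> \<Phi> \<nu> + d"
    "\<And>\<phi>. \<phi> \<in> Cfun X \<Longrightarrow> (\<And>\<nu>. \<nu> \<in> topspace (OH X) \<Longrightarrow> \<nu> \<phi> \<le> \<Phi> \<nu>) \<Longrightarrow>
       \<exists>q\<in>Q. \<forall>x\<in>topspace X. \<phi> x \<le> q x"
    using finite_dominating_family[OF X \<Phi> \<open>d > 0\<close>] by blast
  obtain R where R: "finite R" "R \<subseteq> Cfun X"
    "\<And>q \<nu>. q \<in> R \<Longrightarrow> \<nu> \<in> topspace (OH X) \<Longrightarrow> \<Phi> \<nu> - d \<le> \<nu> q"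
    "\<And>\<phi>. \<phi> \<in> Cfun X \<Longrightarrow> (\<And>\<nu>. \<nu> \<in> topspace (OH X) \<Longrightarrow> \<Phi> \<nu> \<le> \<nu> \<phi>) \<Longrightarrow>
       \<exists>q\<in>R. \<forall>x\<in>topspace X. q x \<le> \<phi> x"
    using finite_dominated_family[OF X \<Phi> \<open>d > 0\<close>] by blast
  define N where "N = {\<kappa> \<in> topspace (OH X). \<forall>q\<in>Q \<union> R. \<bar>\<kappa> q - ?m q\<bar> < d}"
  have mono: "\<kappa> f \<le> \<kappa> g"
    if "\<kappa> \<in> N" "f \<in> Cfun X" "g \<in> Cfun X" "\<forall>x\<in>topspace X. f x \<le> g x" for \<kappa> f g
  proof -
    have "\<kappa> \<in> topspace (OH X)" using that(1) by (simp add: N_def)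
    from weak_functional_mono[OF OH_weak_functional[OF this] CfunD(1) CfunD(1), of f g]
    show ?thesis using that by (simp add: ev_Cfun)
  qed
  show ?thesis
  proof (rule that)
    show "openin (OH X) N"
      unfolding N_def using Q(1,2) R(1,2) by (intro openin_OH_basic) auto
    show "?m \<in> N" using muOH_in_OH[OF X \<Lambda>] \<open>d > 0\<close> by (simp add: N_def)
  next
    fix \<kappa> \<phi>
    assume \<kappa>: "\<kappa> \<in> N" and \<phi>: "\<phi> \<in> Cfun X" "\<And>l. l \<in> topspace (OH X) \<Longrightarrow> l \<phi> \<le> \<Phi> l"
    obtain q where q: "q \<in> Q" "\<forall>x\<in>topspace X. \<phi> x \<le> q x" using Q(4)[OF \<phi>] by blast
    have qC: "q \<in> Cfun X" using q(1) Q(2) by blast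
    have "\<kappa> \<phi> \<le> \<kappa> q" by (rule mono[OF \<kappa> \<phi>(1) qC q(2)])
    moreover have "\<bar>\<kappa> q - ?m q\<bar> < d" using \<kappa> q(1) by (auto simp: N_def)
    moreover have "?m q \<le> ev (OH X) \<Lambda> (\<lambda>l. \<Phi> l + d)"
      unfolding muOH_apply[OF qC] using Q(3)[OF q(1)]
      by (intro weak_functional_mono[OF V] cts_OH_eval qC continuous_map_add \<Phi>) auto
    ultimately show "\<kappa> \<phi> \<le> ev (OH X) \<Lambda> \<Phi> + e"
      using weak_functional_add[OF V \<Phi>, of d] unfolding d_def by linarith
  next
    fix \<kappa> \<phi>
    assume \<kappa>: "\<kappa> \<in> N" and \<phi>: "\<phi> \<in> Cfun X" "\<And>l. l \<in> topspace (OH X) \<Longrightarrow> \<Phi> l \<le> l \<phi>"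
    obtain q where q: "q \<in> R" "\<forall>x\<in>topspace X. q x \<le> \<phi> x" using R(4)[OF \<phi>] by blast
    have qC: "q \<in> Cfun X" using q(1) R(2) by blast
    have "\<kappa> q \<le> \<kappa> \<phi>" by (rule mono[OF \<kappa> qC \<phi>(1) q(2)])
    moreover have "\<bar>\<kappa> q - ?m q\<bar> < d" using \<kappa> q(1) by (auto simp: N_def)
    moreover have "ev (OH X) \<Lambda> (\<lambda>l. \<Phi> l + (- d)) \<le> ?m q"
      unfolding muOH_apply[OF qC] using R(3)[OF q(1)]
      by (intro weak_functional_mono[OF V] cts_OH_eval qC continuous_map_add \<Phi>) auto
    ultimately show "ev (OH X) \<Lambda> \<Phi> - e \<le> \<kappa> \<phi>"
      using weak_functional_add[OF V \<Phi>, of "- d"] unfolding d_def by linarith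
  qed
qed

lemma muOH_restrict_eq:
  assumes X: "compact_space X" and \<kappa>: "\<kappa> \<in> topspace (OH X)" and W: "weak_functional (OH X) W"
    and eval: "\<And>\<phi>. \<phi> \<in> Cfun X \<Longrightarrow> W (\<lambda>l. l \<phi>) = \<kappa> \<phi>"
  shows "muOH X (restrict W (Cfun (OH X))) = \<kappa>"
proof
  fix \<phi>
  show "muOH X (restrict W (Cfun (OH X))) \<phi> = \<kappa> \<phi>"
  proof (cases "\<phi> \<in> Cfun X")
    case True
    then show ?thesis
      using weak_functional_ev[OF W cts_OH_eval[OF True]] eval[OF True] by (simp add: muOH_apply)
  next
    case False
    then show ?thesis
      using \<kappa> by (auto simp: muOH_def topspace_OH[OF X] extensional_def)
  qed
qed

theorem theorem3:
  fixes X :: "'a topology"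
  assumes "compact_space X" and "Hausdorff_space X"
  shows "open_map (OH (OH X)) (OH X) (muOH X)"
  unfolding open_map_def
proof (intro allI impI)
  note X = assms(1)
  fix U assume U: "openin (OH (OH X)) U"
  show "openin (OH X) (muOH X ` U)"
  proof (subst openin_subopen, intro ballI)
    fix \<nu> assume "\<nu> \<in> muOH X ` U"
    then obtain \<Lambda> where \<Lambda>: "\<Lambda> \<in> U" "\<nu> = muOH X \<Lambda>" by blast
    have \<Lambda>t: "\<Lambda> \<in> topspace (OH (OH X))" using U \<Lambda>(1) openin_subset by blast
    note V = OH_weak_functional[OF \<Lambda>t]
    obtain F \<tau> where F: "finite F" "F \<subseteq> Cfun (OH X)" "\<tau> > 0"
      "\<And>\<Lambda>'. \<Lambda>' \<in> topspace (OH (OH X)) \<Longrightarrow> (\<And>\<Phi>. \<Phi> \<in> F \<Longrightarrow> \<bar>\<Lambda>' \<Phi> - \<Lambda> \<Phi>\<bar> < \<tau>) \<Longrightarrow> \<Lambda>' \<in> U"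
      using OH_basic_neighbourhood[OF U \<Lambda>(1)] by blast
    \<comment> \<open>Halving turns the non-strict estimates for the clamped functional into the
      strict bound \<tau>.\<close>
    define e where "e = \<tau> / 2"
    have e: "e > 0" "e < \<tau>" using F(3) by (auto simp: e_def)
    \<comment> \<open>This says that the smallest functional for \<kappa> is at most
      \<Lambda>(\<Phi>) + e at \<Phi> and the largest at least \<Lambda>(\<Phi>) - e, spelled out on
      the prescribed values.\<close>
    define near where "near = (\<lambda>\<Phi> \<kappa>.
      (\<forall>\<phi>\<in>Cfun X. (\<forall>l\<in>topspace (OH X). l \<phi> \<le> \<Phi> l) \<longrightarrow> \<kappa> \<phi> \<le> ev (OH X) \<Lambda> \<Phi> + e) \<and>
      (\<forall>\<phi>\<in>Cfun X. (\<forall>l\<in>topspace (OH X). \<Phi> l \<le> l \<phi>) \<longrightarrow> ev (OH X) \<Lambda> \<Phi> - e \<le> \<kappa> \<phi>))"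
    have "\<exists>N. openin (OH X) N \<and> \<nu> \<in> N \<and> (\<forall>\<kappa>\<in>N. near \<Phi> \<kappa>)" if "\<Phi> \<in> F" for \<Phi>
    proof -
      have "cts (OH X) \<Phi>" using that F(2) CfunD(1) by blast
      from OH_neighbourhood_near_fibre[OF X \<Lambda>t this e(1)]
      obtain N where "openin (OH X) N" "muOH X \<Lambda> \<in> N"
        "\<And>\<kappa> \<phi>. \<kappa> \<in> N \<Longrightarrow> \<phi> \<in> Cfun X \<Longrightarrow> (\<And>l. l \<in> topspace (OH X) \<Longrightarrow> l \<phi> \<le> \<Phi> l) \<Longrightarrow>
           \<kappa> \<phi> \<le> ev (OH X) \<Lambda> \<Phi> + e"
        "\<And>\<kappa> \<phi>. \<kappa> \<in> N \<Longrightarrow> \<phi> \<in> Cfun X \<Longrightarrow> (\<And>l. l \<in> topspace (OH X) \<Longrightarrow> \<Phi> l \<le> l \<phi>) \<Longrightarrow>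
           ev (OH X) \<Lambda> \<Phi> - e \<le> \<kappa> \<phi>"
        by blast
      then show ?thesis
        unfolding near_def \<Lambda>(2) by (intro exI[of _ N]) simp
    qed
    then obtain N where N: "\<And>\<Phi>. \<Phi> \<in> F \<Longrightarrow> openin (OH X) (N \<Phi>)" "\<And>\<Phi>. \<Phi> \<in> F \<Longrightarrow> \<nu> \<in> N \<Phi>"
      "\<And>\<Phi> \<kappa>. \<Phi> \<in> F \<Longrightarrow> \<kappa> \<in> N \<Phi> \<Longrightarrow> near \<Phi> \<kappa>"
      by metis
    \<comment> \<open>Inserting the whole space keeps the intersection open when \<open>F\<close> is
      empty.\<close>
    define M where "M = \<Inter> (insert (topspace (OH X)) (N ` F))"
    have "openin (OH X) M" unfolding M_def using F(1) N(1) by (intro openin_Inter) auto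
    moreover have "\<nu> \<in> M" unfolding M_def using muOH_in_OH[OF X \<Lambda>t] \<Lambda>(2) N(2) by auto
    moreover have "M \<subseteq> muOH X ` U"
    proof
      fix \<kappa> assume "\<kappa> \<in> M"
      then have \<kappa>: "\<kappa> \<in> topspace (OH X)" "\<And>\<Phi>. \<Phi> \<in> F \<Longrightarrow> near \<Phi> \<kappa>"
        using N(3) by (auto simp: M_def)
      let ?W = "clamp_OH X \<kappa> (ev (OH X) \<Lambda>)"
      note W = weak_functional_clamp_OH[OF V \<kappa>(1)]
      let ?\<Lambda> = "restrict ?W (Cfun (OH X))"
      have "?\<Lambda> \<in> U"
      proof (rule F(4)[OF weak_functional_in_OH[OF compact_space_OH W]])
        fix \<Phi> assume \<Phi>: "\<Phi> \<in> F"
        have \<Phi>C: "\<Phi> \<in> Cfun (OH X)" using \<Phi> F(2) by blast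
        have "?W \<Phi> \<le> ev (OH X) \<Lambda> \<Phi> + e"
          by (rule clamp_OH_le[OF V \<kappa>(1) CfunD(1)[OF \<Phi>C]]) (use \<kappa>(2)[OF \<Phi>] e in \<open>simp_all add: near_def\<close>)
        moreover have "ev (OH X) \<Lambda> \<Phi> - e \<le> ?W \<Phi>"
          by (rule clamp_OH_ge[OF V \<kappa>(1) CfunD(1)[OF \<Phi>C]]) (use \<kappa>(2)[OF \<Phi>] e in \<open>simp_all add: near_def\<close>)
        ultimately show "\<bar>?\<Lambda> \<Phi> - \<Lambda> \<Phi>\<bar> < \<tau>" using \<Phi>C e(2) by (simp add: ev_Cfun abs_less_iff)
      qed
      moreover have "muOH X ?\<Lambda> = \<kappa>"
        by (rule muOH_restrict_eq[OF X \<kappa>(1) W]) (simp add: clamp_OH_eval[OF V \<kappa>(1)])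
      ultimately show "\<kappa> \<in> muOH X ` U" by (metis image_eqI)
    qed
    ultimately show "\<exists>T. openin (OH X) T \<and> \<nu> \<in> T \<and> T \<subseteq> muOH X ` U" by blast
  qed
qed

end
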